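(* Let $\mu$ and $\nu$ be finite Borel measures on a complete separable metric space $Z$. (i) For $\epsilon\ge0$, $d_P(\mu,\nu)\le\epsilon$ if and only if there is a Borel measure $\alpha$ on $Z\times Z$ such that $D(\alpha;\mu,\nu)+\alpha(\{(x,y):d(x,y)>\epsilon\})\le\epsilon$. (ii) Equivalently, $d_P(\mu,\nu)=\min\{\epsilon\ge0:\exists\alpha:\ D(\alpha;\mu,\nu)+\alpha(\{(x,y):d(x,y)>\epsilon\})\le\epsilon\}$, and the minimum is attained. (iii) In addition, if $\mu(Z)\le\nu(Z)$, then the minimum in (ii) is attained for $\epsilon:=d_P(\mu,\nu)$ and some $\alpha$ with $\pi_{1*}\alpha=\mu$ and $\pi_{2*}\alpha\le\nu$; moreover $\alpha$ can be chosen to be supported on $\mathrm{supp}(\mu)\times\mathrm{supp}(\nu)$.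
   Context: For a closed set $A\subseteq Z$ and $\epsilon\ge0$, $A^\epsilon=\{z\in Z:\exists a\in A,\ d(z,a)\le\epsilon\}$. The Prokhorov distance is $d_P(\mu,\nu)=\inf\{\epsilon>0: \mu(A)\le\nu(A^\epsilon)+\epsilon \text{ and } \nu(A)\le\mu(A^\epsilon)+\epsilon \text{ for all closed } A\subseteq Z\}$. $\pi_1,\pi_2$ are the projections of $Z\times Z$ onto its factors and $f_*$ denotes push-forward. The total variation distance of measures is $\|\mu-\nu\|_{TV}=\sup_A|\mu(A)-\nu(A)|$ over Borel sets $A$. For a finite Borel measure $\alpha$ on $Z\times Z$, the discrepancy is $D(\alpha;\mu,\nu):=\|\pi_{1*}\alpha-\mu\|_{TV}+\|\pi_{2*}\alpha-\nu\|_{TV}$. *)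

theory Defs
  imports "HOL-Analysis.Analysis"
begin

definition cthick :: "'a::metric_space set \<Rightarrow> real \<Rightarrow> 'a set" where
  "cthick A e = {z. \<exists>a\<in>A. dist z a \<le> e}"

definition finite_borel_measure :: "'a::topological_space measure \<Rightarrow> bool" where
  "finite_borel_measure M \<longleftrightarrow> sets M = sets borel \<and> finite_measure M"

text \<open>Prokhorov distance. The enlargement of a closed set is in general only
  universally measurable (analytic), so it is measured with the completion of the
  measure (which agrees with the measure on Borel sets).\<close>
definition prokhorov_dist :: "'a::metric_space measure \<Rightarrow> 'a measure \<Rightarrow> real" where
  "prokhorov_dist \<mu> \<nu> = Inf {e. e > 0 \<and> (\<forall>A. closed A \<longrightarrow>
       measure \<mu> A \<le> measure (completion \<nu>) (cthick A e) + e \<and>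
       measure \<nu> A \<le> measure (completion \<mu>) (cthick A e) + e)}"

definition tv_dist :: "'a::topological_space measure \<Rightarrow> 'a measure \<Rightarrow> real" where
  "tv_dist \<mu> \<nu> = (SUP A\<in>sets borel. \<bar>measure \<mu> A - measure \<nu> A\<bar>)"

definition discrepancy :: "('a::topological_space \<times> 'a) measure \<Rightarrow> 'a measure \<Rightarrow> 'a measure \<Rightarrow> real" where
  "discrepancy \<alpha> \<mu> \<nu> = tv_dist (distr \<alpha> borel fst) \<mu> + tv_dist (distr \<alpha> borel snd) \<nu>"

definition msupp :: "'a::metric_space measure \<Rightarrow> 'a set" where
  "msupp M = {z. \<forall>r>0. emeasure M (ball z r) > 0}"

definition coupling_ok :: "('a::metric_space \<times> 'a) measure \<Rightarrow> 'a measure \<Rightarrow> 'a measure \<Rightarrow> real \<Rightarrow> bool" where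
  "coupling_ok \<alpha> \<mu> \<nu> e \<longleftrightarrow>
     discrepancy \<alpha> \<mu> \<nu> + measure \<alpha> {(x, y). dist x y > e} \<le> e"

end

theory Submission
  imports Defs
begin

text \<open>
  The hard direction produces a coupling at \<open>d = prokhorov_dist \<mu> \<nu>\<close> when \<open>\<mu>\<close> has the smaller mass.
  Let \<open>S = {(x, y). dist x y \<le> d}\<close>. For finite families of measurable sets, a fractional Hall theorem on
  their atoms gives a finitely supported measure whose marginals are below \<open>\<mu>\<close> and \<open>\<nu>\<close> on the families,
  which charges only pairs of atoms meeting \<open>S\<close>, and whose mass is at least \<open>\<nu>(Z) - d\<close>. Tychonoff's
  theorem yields a finitely additive set function with these properties for all Borel sets at once.
  Since its marginals are dominated by Radon measures, it is countably additive on rectangles, so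
  Caratheodory's theorem turns it into a measure, concentrated on \<open>S\<close>. A multiple of the product of the
  two remainders then matches the rest of \<open>\<mu>\<close>.

  In the converse direction the thickening of a closed set is the projection of a closed set, hence
  universally measurable, so that its completed measure is not the junk value \<open>0\<close>.
\<close>

section \<open>Maximal fractional matchings\<close>

lemma compact_Pi_UNIV:
  fixes S :: "'i \<Rightarrow> 'b::topological_space set"
  assumes "\<And>i. compact (S i)"
  shows "compact (Pi UNIV S)"
proof -
  have "compactin (product_topology (\<lambda>_. euclidean) UNIV) (PiE UNIV S)"
    using assms by (simp add: compactin_PiE)
  then show ?thesis
    by (simp add: euclidean_product_topology PiE_UNIV_domain)
qed

locale bipartite_network =
  fixes I :: "'i set" and J :: "'j set" and E :: "('i \<times> 'j) set"
    and a :: "'i \<Rightarrow> real" and b :: "'j \<Rightarrow> real"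
  assumes finite_I: "finite I" and finite_J: "finite J" and E_subset: "E \<subseteq> I \<times> J"
    and a_nonneg: "i \<in> I \<Longrightarrow> 0 \<le> a i" and b_nonneg: "j \<in> J \<Longrightarrow> 0 \<le> b j"
begin

definition row :: "('i \<times> 'j \<Rightarrow> real) \<Rightarrow> 'i \<Rightarrow> real" where
  "row x i = (\<Sum>j\<in>J. x (i, j))"

definition col :: "('i \<times> 'j \<Rightarrow> real) \<Rightarrow> 'j \<Rightarrow> real" where
  "col x j = (\<Sum>i\<in>I. x (i, j))"

definition mass :: "('i \<times> 'j \<Rightarrow> real) \<Rightarrow> real" where
  "mass x = sum x (I \<times> J)"

definition matching :: "('i \<times> 'j \<Rightarrow> real) \<Rightarrow> bool" where
  "matching x \<longleftrightarrow> (\<forall>e. 0 \<le> x e) \<and> (\<forall>e. e \<notin> E \<longrightarrow> x e = 0)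
     \<and> (\<forall>i\<in>I. row x i \<le> a i) \<and> (\<forall>j\<in>J. col x j \<le> b j)"

definition maximum_matching :: "('i \<times> 'j \<Rightarrow> real) \<Rightarrow> bool" where
  "maximum_matching x \<longleftrightarrow> matching x \<and> (\<forall>y. matching y \<longrightarrow> mass y \<le> mass x)"

definition deficient :: "('i \<times> 'j \<Rightarrow> real) \<Rightarrow> 'j set" where
  "deficient x = {j\<in>J. col x j < b j}"

lemma matchingD:
  assumes "matching x"
  shows "0 \<le> x e" and "e \<notin> E \<Longrightarrow> x e = 0"
    and "i \<in> I \<Longrightarrow> row x i \<le> a i" and "j \<in> J \<Longrightarrow> col x j \<le> b j"
  using assms unfolding matching_def by blast+

lemma mass_eq_sum_row: "mass x = (\<Sum>i\<in>I. row x i)"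
  by (simp add: mass_def row_def sum.cartesian_product)

lemma mass_eq_sum_col: "mass x = (\<Sum>j\<in>J. col x j)"
  unfolding mass_eq_sum_row row_def col_def by (rule sum.swap)

lemma row_fun_upd:
  assumes "j \<in> J"
  shows "row (x((i, j) := v)) k = row x k + (if k = i then v - x (i, j) else 0)"
proof -
  have "(\<Sum>l\<in>J - {j}. (x((i, j) := v)) (k, l)) = (\<Sum>l\<in>J - {j}. x (k, l))"
    by (rule sum.cong) auto
  then show ?thesis
    by (simp add: row_def sum.remove[OF finite_J assms])
qed

lemma col_fun_upd:
  assumes "i \<in> I"
  shows "col (x((i, j) := v)) l = col x l + (if l = j then v - x (i, j) else 0)"
proof -
  have "(\<Sum>k\<in>I - {i}. (x((i, j) := v)) (k, l)) = (\<Sum>k\<in>I - {i}. x (k, l))"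
    by (rule sum.cong) auto
  then show ?thesis
    by (simp add: col_def sum.remove[OF finite_I assms])
qed

lemma mass_fun_upd:
  assumes "i \<in> I" "j \<in> J"
  shows "mass (x((i, j) := v)) = mass x + v - x (i, j)"
  by (simp add: mass_eq_sum_row row_fun_upd[OF assms(2)] sum.distrib finite_I assms(1))

lemma compact_matchings: "compact {x. matching x}"
proof -
  define S where "S e = (if e \<in> E then {0..b (snd e)} else {0})" for e :: "'i \<times> 'j"
  have "x e \<in> S e" if "matching x" for x e
  proof (cases "e \<in> E")
    case True
    then obtain i j where e: "e = (i, j)" "i \<in> I" "j \<in> J"
      using E_subset by auto
    have "x (i, j) \<le> col x j"
      unfolding col_def using that e(2) finite_I
      by (intro member_le_sum) (auto simp: matching_def)
    also have "\<dots> \<le> b j"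
      using that e(3) by (simp add: matching_def)
    finally show ?thesis
      using matchingD(1)[OF that] True e(1) by (simp add: S_def)
  qed (simp add: S_def matchingD(2)[OF that])
  then have "{x. matching x} = Pi UNIV S \<inter> {x. matching x}"
    by auto
  moreover have "closed {x. matching x}"
    unfolding matching_def row_def col_def Ball_def
    by (intro closed_Collect_conj closed_Collect_all closed_Collect_imp open_Collect_const
        closed_Collect_le closed_Collect_eq continuous_intros continuous_on_product_coordinates)
  moreover have "compact (Pi UNIV S)"
    by (intro compact_Pi_UNIV) (simp add: S_def)
  ultimately show ?thesis
    by (metis compact_Int_closed)
qed

lemma ex_maximum_matching: "\<exists>x. maximum_matching x"
proof -
  have "matching (\<lambda>_. 0)"
    by (simp add: matching_def row_def col_def a_nonneg b_nonneg)
  moreover have "continuous_on {x. matching x} mass"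
    unfolding mass_def
    by (intro continuous_on_sum continuous_on_subset[OF continuous_on_product_coordinates]) auto
  ultimately show ?thesis
    using continuous_attains_sup[OF compact_matchings, of mass]
    unfolding maximum_matching_def by blast
qed

lemma maximum_matching_saturates_neighbours:
  assumes x: "maximum_matching x" and ij: "(i, j) \<in> E" "j \<in> deficient x"
  shows "row x i = a i"
proof (rule ccontr)
  assume unsaturated: "row x i \<noteq> a i"
  have matching: "matching x" and IJ: "i \<in> I" "j \<in> J"
    using x ij E_subset by (auto simp: maximum_matching_def)
  define t where "t = min (a i - row x i) (b j - col x j)"
  have t: "0 < t" "t \<le> a i - row x i" "t \<le> b j - col x j"
    using unsaturated matchingD(3)[OF matching IJ(1)] ij(2) by (auto simp: t_def deficient_def)
  have "matching (x((i, j) := x (i, j) + t))"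
    using matching t ij(1) by (auto simp: matching_def row_fun_upd[OF IJ(2)] col_fun_upd[OF IJ(1)])
  then show False
    using x t(1) IJ by (force simp: maximum_matching_def mass_fun_upd)
qed

lemma maximum_matching_reroute:
  assumes x: "maximum_matching x" and ij: "(i, j) \<in> E" "j \<in> deficient x"
    and j': "0 < x (i, j')" "j' \<notin> deficient x"
  obtains y where "maximum_matching y" "insert j' (deficient x) \<subseteq> deficient y"
proof
  have matching: "matching x" and ij': "(i, j') \<in> E"
    using x j'(1) matchingD(2)[of x "(i, j')"] by (auto simp: maximum_matching_def)
  have IJ: "i \<in> I" "j \<in> J" "j' \<in> J" "j \<noteq> j'"
    using E_subset ij ij' j'(2) by auto
  define t where "t = min (x (i, j')) ((b j - col x j) / 2)"
  have t: "0 < t" "t \<le> x (i, j')" "col x j + t < b j"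
    using ij(2) j'(1) by (auto simp: t_def deficient_def min_def field_simps)
  define y where "y = x((i, j) := x (i, j) + t, (i, j') := x (i, j') - t)"
  have row_y: "row y k = row x k" for k
    using IJ by (simp add: y_def row_fun_upd)
  have col_y: "col y l = col x l + (if l = j then t else 0) - (if l = j' then t else 0)" for l
    using IJ by (simp add: y_def col_fun_upd)
  have "matching y"
    using matching t ij(1) ij' unfolding matching_def row_y col_y by (auto simp: y_def)
  then show "maximum_matching y"
    using x by (simp add: maximum_matching_def mass_eq_sum_row row_y)
  show "insert j' (deficient x) \<subseteq> deficient y"
  proof -
    have "col y j' < b j'"
      using matchingD(4)[OF matching IJ(3)] t(1) IJ(4) by (simp add: col_y)
    then show ?thesis
      using t IJ by (auto simp: deficient_def col_y)
  qed
qed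

text \<open>Among the maximum matchings, one with as many deficient columns as possible admits no
  rerouting, so its deficient columns and their neighbours form a minimum cut.\<close>

lemma ex_rerouting_closed_maximum_matching:
  obtains x where "maximum_matching x"
    "\<And>i j j'. (i, j) \<in> E \<Longrightarrow> j \<in> deficient x \<Longrightarrow> 0 < x (i, j') \<Longrightarrow> j' \<in> deficient x"
proof -
  have fin: "finite (deficient x)" for x
    using finite_J by (simp add: deficient_def)
  have "card (deficient x) < Suc (card J)" for x
    using finite_J by (auto simp: deficient_def less_Suc_eq_le intro!: card_mono)
  then obtain x where x: "maximum_matching x"
    "\<And>y. maximum_matching y \<Longrightarrow> card (deficient y) \<le> card (deficient x)"
    using ex_maximum_matching ex_has_greatest_nat[of maximum_matching _ "\<lambda>x. card (deficient x)"]
    by blast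
  show thesis
  proof (rule that[OF x(1)], rule ccontr)
    fix i j j' assume "(i, j) \<in> E" "j \<in> deficient x" "0 < x (i, j')" "j' \<notin> deficient x"
    then obtain y where "maximum_matching y" "insert j' (deficient x) \<subseteq> deficient y"
      by (rule maximum_matching_reroute[OF x(1)])
    then have "card (deficient x) < card (deficient y)" "maximum_matching y"
      using \<open>j' \<notin> deficient x\<close> fin by (auto intro!: psubset_card_mono)
    then show False
      using x(2) by force
  qed
qed

theorem ex_matching_of_hall_deficit:
  assumes hall: "\<And>K. K \<subseteq> J \<Longrightarrow> sum b K \<le> sum a (E\<inverse> `` K) + c"
  obtains x where "matching x" "sum b J - c \<le> mass x"
proof -
  obtain x where x: "maximum_matching x"
    "\<And>i j j'. (i, j) \<in> E \<Longrightarrow> j \<in> deficient x \<Longrightarrow> 0 < x (i, j') \<Longrightarrow> j' \<in> deficient x"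
    by (rule ex_rerouting_closed_maximum_matching) blast
  then have matching: "matching x"
    by (simp add: maximum_matching_def)
  define D N where "D = deficient x" and "N = E\<inverse> `` D"
  have D: "D \<subseteq> J" and N: "N \<subseteq> I"
    using E_subset by (auto simp: D_def N_def deficient_def)
  have leaving_0: "x (i, j) = 0" if "i \<in> N" "j \<in> J - D" for i j
  proof (rule ccontr)
    assume "x (i, j) \<noteq> 0"
    then have "0 < x (i, j)"
      using matchingD(1)[OF matching, of "(i, j)"] by simp
    then show False
      using x(2)[of i _ j] that by (auto simp: N_def D_def)
  qed
  have entering_0: "x (i, j) = 0" if "i \<in> I - N" "j \<in> D" for i j
    using that by (intro matchingD(2)[OF matching]) (auto simp: N_def)
  have "sum a N = (\<Sum>i\<in>N. row x i)"
    using maximum_matching_saturates_neighbours[OF x(1)] by (auto simp: N_def D_def intro!: sum.cong)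
  also have "\<dots> = (\<Sum>i\<in>N. \<Sum>j\<in>D. x (i, j))"
    unfolding row_def using leaving_0 finite_J D
    by (intro sum.cong sum.mono_neutral_right) auto
  also have "\<dots> = (\<Sum>j\<in>D. \<Sum>i\<in>N. x (i, j))"
    by (rule sum.swap)
  also have "\<dots> = (\<Sum>j\<in>D. col x j)"
    unfolding col_def using entering_0 finite_I N
    by (intro sum.cong sum.mono_neutral_left) auto
  finally have "sum a N = (\<Sum>j\<in>D. col x j)" .
  moreover have "sum b (J - D) = (\<Sum>j\<in>J - D. col x j)"
    using matching by (intro sum.cong) (auto simp: D_def deficient_def matching_def)
  ultimately have "mass x = sum a N + sum b (J - D)"
    using sum.subset_diff[OF D finite_J, of "col x"] by (simp add: mass_eq_sum_col)
  moreover have "sum b J = sum b (J - D) + sum b D"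
    by (rule sum.subset_diff[OF D finite_J])
  ultimately have "sum b J - c \<le> mass x"
    using hall[OF D] by (simp add: N_def)
  with matching show thesis
    by (rule that)
qed

end

section \<open>Partial couplings by positive charges\<close>

definition positive_charge :: "('a set \<Rightarrow> real) \<Rightarrow> bool" where
  "positive_charge f \<longleftrightarrow> (\<forall>R. 0 \<le> f R) \<and> (\<forall>R T. R \<inter> T = {} \<longrightarrow> f (R \<union> T) = f R + f T)"

lemma positive_charge_nonneg: "positive_charge f \<Longrightarrow> 0 \<le> f R"
  by (simp add: positive_charge_def)

lemma positive_charge_Un: "positive_charge f \<Longrightarrow> R \<inter> T = {} \<Longrightarrow> f (R \<union> T) = f R + f T"
  by (simp add: positive_charge_def)

lemma positive_charge_empty: "positive_charge f \<Longrightarrow> f {} = 0"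
  using positive_charge_Un[of f "{}" "{}"] by simp

lemma positive_charge_Diff:
  assumes "positive_charge f" "R \<subseteq> T"
  shows "f T = f R + f (T - R)"
  using positive_charge_Un[OF assms(1), of R "T - R"] assms(2) by (simp add: Un_absorb1)

lemma positive_charge_mono:
  assumes "positive_charge f" "R \<subseteq> T"
  shows "f R \<le> f T"
  using positive_charge_Diff[OF assms] positive_charge_nonneg[OF assms(1), of "T - R"] by simp

lemma positive_charge_subadditive:
  assumes "positive_charge f"
  shows "f (R \<union> T) \<le> f R + f T"
  using positive_charge_Un[OF assms, of R "T - R"] positive_charge_mono[OF assms, of "T - R" T] by simp

lemma positive_charge_UN_le:
  assumes "positive_charge f" "finite I"
  shows "f (\<Union>i\<in>I. T i) \<le> (\<Sum>i\<in>I. f (T i))"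
  using assms(2)
proof induction
  case (insert i I)
  then show ?case
    using positive_charge_subadditive[OF assms(1), of "T i" "\<Union>i\<in>I. T i"] by simp
qed (simp add: positive_charge_empty[OF assms(1)])

lemma positive_charge_UN_disjoint:
  assumes "positive_charge f" "finite I" "disjoint_family_on T I"
  shows "f (\<Union>i\<in>I. T i) = (\<Sum>i\<in>I. f (T i))"
  using assms(2,3)
proof induction
  case (insert i I)
  then have "T i \<inter> (\<Union>i\<in>I. T i) = {}" "disjoint_family_on T I"
    by (auto simp: disjoint_family_on_def)
  then show ?case
    using insert positive_charge_Un[OF assms(1)] by simp
qed (simp add: positive_charge_empty[OF assms(1)])

lemma positive_charge_sum_vimage:
  assumes "finite X" "\<And>s. s \<in> X \<Longrightarrow> 0 \<le> w s"
  shows "positive_charge (\<lambda>T. sum w {s\<in>X. p s \<in> T})"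
  unfolding positive_charge_def
proof (intro conjI allI impI)
  fix R T :: "'b set" assume "R \<inter> T = {}"
  moreover have "{s\<in>X. p s \<in> R \<union> T} = {s\<in>X. p s \<in> R} \<union> {s\<in>X. p s \<in> T}"
    by auto
  ultimately show "sum w {s\<in>X. p s \<in> R \<union> T} = sum w {s\<in>X. p s \<in> R} + sum w {s\<in>X. p s \<in> T}"
    using assms(1) by (simp add: sum.union_disjoint disjoint_iff)
qed (use assms(2) in \<open>auto intro: sum_nonneg\<close>)

definition marginals_le_on ::
  "'a set set \<Rightarrow> 'b set set \<Rightarrow> (('a \<times> 'b) set \<Rightarrow> real) \<Rightarrow> 'a measure \<Rightarrow> 'b measure \<Rightarrow> bool" where
  "marginals_le_on F G f M N \<longleftrightarrow>
     (\<forall>A\<in>F. f (A \<times> space N) \<le> measure M A) \<and> (\<forall>B\<in>G. f (space M \<times> B) \<le> measure N B)"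

text \<open>The section \<open>S\<inverse> `` B\<close> need not be measurable, hence the quantification over \<open>U\<close>.\<close>

definition strassen_condition :: "('a \<times> 'b) set \<Rightarrow> real \<Rightarrow> 'a measure \<Rightarrow> 'b measure \<Rightarrow> bool" where
  "strassen_condition S c M N \<longleftrightarrow>
     (\<forall>B\<in>sets N. \<forall>U\<in>sets M. S\<inverse> `` B \<inter> space M \<subseteq> U \<longrightarrow> measure N B \<le> measure M U + c)"

lemma strassen_conditionD:
  assumes "strassen_condition S c M N" "B \<in> sets N" "U \<in> sets M" "S\<inverse> `` B \<inter> space M \<subseteq> U"
  shows "measure N B \<le> measure M U + c"
  using assms by (simp add: strassen_condition_def)

definition partial_coupling_charge ::
  "'a set set \<Rightarrow> 'b set set \<Rightarrow> ('a \<times> 'b) set \<Rightarrow> real \<Rightarrow> 'a measure \<Rightarrow> 'b measure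
    \<Rightarrow> (('a \<times> 'b) set \<Rightarrow> real) \<Rightarrow> bool" where
  "partial_coupling_charge F G S c M N \<beta> \<longleftrightarrow>
     positive_charge \<beta> \<and> marginals_le_on F G \<beta> M N
     \<and> \<beta> UNIV \<le> measure N (space N) \<and> measure N (space N) - c \<le> \<beta> (space M \<times> space N)
     \<and> (\<forall>A\<in>F. \<forall>B\<in>G. (A \<times> B) \<inter> S = {} \<longrightarrow> \<beta> (A \<times> B) = 0)"

lemma (in finite_measure) measure_vimage_simple_function:
  assumes "simple_function M f" "K \<subseteq> f ` space M"
  shows "measure M (f -` K \<inter> space M) = (\<Sum>s\<in>K. measure M (f -` {s} \<inter> space M))"
proof -
  have "finite K"
    using assms simple_functionD(1) finite_subset by blast
  then have "measure M (\<Union>s\<in>K. f -` {s} \<inter> space M) = (\<Sum>s\<in>K. measure M (f -` {s} \<inter> space M))"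
    using simple_functionD(2)[OF assms(1)]
    by (intro finite_measure_finite_Union) (auto simp: disjoint_family_on_def)
  moreover have "f -` K \<inter> space M = (\<Union>s\<in>K. f -` {s} \<inter> space M)"
    by auto
  ultimately show ?thesis
    by simp
qed

definition membership :: "'a set set \<Rightarrow> 'a \<Rightarrow> 'a set set" where
  "membership F z = {A\<in>F. z \<in> A}"

lemma membership_eq_iff: "membership F u = membership F v \<longleftrightarrow> (\<forall>A\<in>F. u \<in> A \<longleftrightarrow> v \<in> A)"
  unfolding membership_def by blast

lemma simple_function_membership:
  assumes "finite F" "F \<subseteq> sets M"
  shows "simple_function M (membership F)"
  unfolding simple_function_def
proof (intro conjI ballI)
  show "finite (membership F ` space M)"
    by (rule finite_subset[of _ "Pow F"]) (use assms(1) in \<open>auto simp: membership_def\<close>)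
  fix s assume "s \<in> membership F ` space M"
  then obtain u where u: "s = membership F u"
    by blast
  then have "membership F -` {s} \<inter> space M = {v\<in>space M. \<forall>A\<in>F. v \<in> A \<longleftrightarrow> u \<in> A}"
    by (simp add: vimage_def membership_eq_iff Int_def conj_commute)
  also have "\<dots> \<in> sets M"
  proof (intro sets.sets_Collect_finite_All assms(1))
    fix A assume "A \<in> F"
    then have "A \<in> sets M"
      using assms(2) by auto
    moreover from this have "{v\<in>space M. v \<in> A \<longleftrightarrow> u \<in> A} = (if u \<in> A then A else space M - A)"
      using sets.sets_into_space by auto
    ultimately show "{v\<in>space M. v \<in> A \<longleftrightarrow> u \<in> A} \<in> sets M"
      by simp
  qed
  finally show "membership F -` {s} \<inter> space M \<in> sets M" .
qed

lemma membership_representatives: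
  fixes M :: "'a measure"
  assumes "F \<subseteq> sets M"
  defines "I \<equiv> membership F ` space M"
  obtains z where "\<And>s. s \<in> I \<Longrightarrow> z s \<in> space M" "\<And>s A. s \<in> I \<Longrightarrow> z s \<in> A \<Longrightarrow> A \<in> F \<Longrightarrow> A \<in> s"
    "\<And>A. A \<in> F \<Longrightarrow> membership F -` {s\<in>I. z s \<in> A} \<inter> space M = A"
proof
  let ?z = "inv_into (space M) (membership F)"
  have z: "membership F (?z s) = s" if "s \<in> I" for s
    using that by (simp add: I_def f_inv_into_f)
  show "?z s \<in> space M" if "s \<in> I" for s
    using that by (simp add: I_def inv_into_into)
  show "A \<in> s" if "s \<in> I" "?z s \<in> A" "A \<in> F" for s A
    using z[OF that(1)] that(2,3) unfolding membership_def by blast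
  fix A assume A: "A \<in> F"
  have "?z (membership F u) \<in> A \<longleftrightarrow> u \<in> A" if "u \<in> space M" for u
    using z[of "membership F u"] that A by (auto simp: I_def membership_eq_iff)
  moreover have "A \<subseteq> space M"
    using A assms(1) by (intro sets.sets_into_space) auto
  ultimately show "membership F -` {s\<in>I. ?z s \<in> A} \<inter> space M = A"
    by (auto simp: I_def)
qed

lemma sum_eq_0_if_rectangle_avoids:
  assumes "\<And>e. x e \<noteq> 0 \<Longrightarrow> e \<in> map_prod (membership F) (membership G) ` S"
    and "(A \<times> B) \<inter> S = {}" "\<And>s. s \<in> K \<Longrightarrow> A \<in> s" "\<And>t. t \<in> L \<Longrightarrow> B \<in> t"
  shows "sum x (K \<times> L) = 0"
proof (intro sum.neutral ballI, rule ccontr)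
  fix e assume e: "e \<in> K \<times> L" "x e \<noteq> 0"
  then obtain u v where "(u, v) \<in> S" "e = (membership F u, membership G v)"
    using assms(1)[of e] by auto
  moreover from this have "u \<in> A" "v \<in> B"
    using e(1) assms(3)[of "fst e"] assms(4)[of "snd e"] by (simp_all add: membership_def)
  ultimately show False
    using assms(2) by blast
qed

lemma strassen_condition_simple_functions:
  assumes "strassen_condition S c M N" "simple_function M f" "simple_function N g"
  shows "measure N (g -` L \<inter> space N)
    \<le> measure M (f -` ((map_prod f g ` (S \<inter> space M \<times> space N))\<inverse> `` L) \<inter> space M) + c"
proof (rule strassen_conditionD[OF assms(1)])
  show "S\<inverse> `` (g -` L \<inter> space N) \<inter> space M
      \<subseteq> f -` ((map_prod f g ` (S \<inter> space M \<times> space N))\<inverse> `` L) \<inter> space M"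
  proof
    fix u assume "u \<in> S\<inverse> `` (g -` L \<inter> space N) \<inter> space M"
    then obtain v where "(u, v) \<in> S \<inter> space M \<times> space N" "g v \<in> L" "u \<in> space M"
      by auto
    then show "u \<in> f -` ((map_prod f g ` (S \<inter> space M \<times> space N))\<inverse> `` L) \<inter> space M"
      by (auto intro!: image_eqI[of _ _ "(u, v)"])
  qed
qed (rule simple_functionD(2)[OF assms(3)], rule simple_functionD(2)[OF assms(2)])

lemma ex_matching_of_simple_functions:
  assumes M: "finite_measure M" and N: "finite_measure N" and S: "strassen_condition S c M N"
    and f: "simple_function M f" and g: "simple_function N g"
  defines "I \<equiv> f ` space M" and "J \<equiv> g ` space N"
  obtains x where "\<And>e. 0 \<le> x e"
    "\<And>e. x e \<noteq> 0 \<Longrightarrow> e \<in> map_prod f g ` (S \<inter> space M \<times> space N)"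
    "\<And>K. K \<subseteq> I \<Longrightarrow> sum x (K \<times> J) \<le> measure M (f -` K \<inter> space M)"
    "\<And>L. L \<subseteq> J \<Longrightarrow> sum x (I \<times> L) \<le> measure N (g -` L \<inter> space N)"
    "measure N (space N) - c \<le> sum x (I \<times> J)"
proof -
  define E where "E = map_prod f g ` (S \<inter> space M \<times> space N)"
  define a where "a s = measure M (f -` {s} \<inter> space M)" for s
  define b where "b t = measure N (g -` {t} \<inter> space N)" for t
  interpret bipartite_network I J E a b
    using simple_functionD(1)[OF f] simple_functionD(1)[OF g]
    by unfold_locales (auto simp: I_def J_def E_def a_def b_def)
  have sum_a: "sum a K = measure M (f -` K \<inter> space M)" if "K \<subseteq> I" for K
    using finite_measure.measure_vimage_simple_function[OF M f, of K] that by (simp add: I_def a_def)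
  have sum_b: "sum b L = measure N (g -` L \<inter> space N)" if "L \<subseteq> J" for L
    using finite_measure.measure_vimage_simple_function[OF N g, of L] that by (simp add: J_def b_def)
  have "E\<inverse> `` L \<subseteq> I" for L
    using E_subset by auto
  then have "sum b L \<le> sum a (E\<inverse> `` L) + c" if "L \<subseteq> J" for L
    using strassen_condition_simple_functions[OF S f g, of L] that by (simp add: sum_a sum_b E_def)
  then obtain x where x: "matching x" "sum b J - c \<le> mass x"
    by (rule ex_matching_of_hall_deficit)
  show thesis
  proof (rule that)
    show "0 \<le> x e" and "x e \<noteq> 0 \<Longrightarrow> e \<in> map_prod f g ` (S \<inter> space M \<times> space N)" for e
      using matchingD(1,2)[OF x(1), of e] by (auto simp: E_def)
    show "sum x (K \<times> J) \<le> measure M (f -` K \<inter> space M)" if "K \<subseteq> I" for K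
    proof -
      have "(\<Sum>i\<in>K. row x i) \<le> sum a K"
        using matchingD(3)[OF x(1)] that by (intro sum_mono) auto
      then show ?thesis
        using that by (simp add: sum_a row_def sum.cartesian_product)
    qed
    show "sum x (I \<times> L) \<le> measure N (g -` L \<inter> space N)" if "L \<subseteq> J" for L
    proof -
      have "(\<Sum>j\<in>L. col x j) \<le> sum b L"
        using matchingD(4)[OF x(1)] that by (intro sum_mono) auto
      moreover have "(\<Sum>j\<in>L. col x j) = sum x (I \<times> L)"
        unfolding col_def by (subst sum.swap) (simp add: sum.cartesian_product)
      ultimately show ?thesis
        using that by (simp add: sum_b)
    qed
    have "g -` J \<inter> space N = space N"
      by (auto simp: J_def)
    then show "measure N (space N) - c \<le> sum x (I \<times> J)"
      using x(2) by (simp add: sum_b mass_def)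
  qed
qed

lemma ex_partial_coupling_charge_on_finite_families:
  assumes "finite_measure M" "finite_measure N" and S: "strassen_condition S c M N"
    and F: "finite F" "F \<subseteq> sets M" and G: "finite G" "G \<subseteq> sets N"
  obtains \<beta> where "partial_coupling_charge F G S c M N \<beta>"
proof -
  define f g I J where "f = membership F" and "g = membership G"
    and "I = f ` space M" and "J = g ` space N"
  have f: "simple_function M f" and g: "simple_function N g"
    unfolding f_def g_def by (intro simple_function_membership F G)+
  obtain x where x: "\<And>e. 0 \<le> x e"
    "\<And>e. x e \<noteq> 0 \<Longrightarrow> e \<in> map_prod f g ` (S \<inter> space M \<times> space N)"
    "\<And>K. K \<subseteq> I \<Longrightarrow> sum x (K \<times> J) \<le> measure M (f -` K \<inter> space M)"
    "\<And>L. L \<subseteq> J \<Longrightarrow> sum x (I \<times> L) \<le> measure N (g -` L \<inter> space N)"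
    "measure N (space N) - c \<le> sum x (I \<times> J)"
    by (rule ex_matching_of_simple_functions[OF assms(1,2) S f g, folded I_def J_def]) (rule that)
  obtain z where z: "\<And>s. s \<in> I \<Longrightarrow> z s \<in> space M" "\<And>s A. s \<in> I \<Longrightarrow> z s \<in> A \<Longrightarrow> A \<in> F \<Longrightarrow> A \<in> s"
    "\<And>A. A \<in> F \<Longrightarrow> f -` {s\<in>I. z s \<in> A} \<inter> space M = A"
    by (rule membership_representatives[OF F(2), folded f_def, folded I_def]) (rule that)
  obtain w where w: "\<And>t. t \<in> J \<Longrightarrow> w t \<in> space N" "\<And>t B. t \<in> J \<Longrightarrow> w t \<in> B \<Longrightarrow> B \<in> G \<Longrightarrow> B \<in> t"
    "\<And>B. B \<in> G \<Longrightarrow> g -` {t\<in>J. w t \<in> B} \<inter> space N = B"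
    by (rule membership_representatives[OF G(2), folded g_def, folded J_def]) (rule that)
  define \<beta> where "\<beta> T = sum x {e\<in>I \<times> J. map_prod z w e \<in> T}" for T
  have \<beta>_Times: "\<beta> (A \<times> B) = sum x ({s\<in>I. z s \<in> A} \<times> {t\<in>J. w t \<in> B})" for A B
    unfolding \<beta>_def by (intro arg_cong[of _ _ "sum x"]) auto
  have spaces: "{s\<in>I. z s \<in> space M} = I" "{t\<in>J. w t \<in> space N} = J" "g -` J \<inter> space N = space N"
    using z(1) w(1) by (auto simp: J_def)
  have "positive_charge \<beta>"
    unfolding \<beta>_def using simple_functionD(1)[OF f] simple_functionD(1)[OF g] x(1)
    by (intro positive_charge_sum_vimage) (auto simp: I_def J_def)
  moreover have "marginals_le_on F G \<beta> M N"
    unfolding marginals_le_on_def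
  proof (intro conjI ballI)
    show "\<beta> (A \<times> space N) \<le> measure M A" if "A \<in> F" for A
      using x(3)[of "{s\<in>I. z s \<in> A}"] unfolding \<beta>_Times spaces z(3)[OF that] by blast
    show "\<beta> (space M \<times> B) \<le> measure N B" if "B \<in> G" for B
      using x(4)[of "{t\<in>J. w t \<in> B}"] unfolding \<beta>_Times spaces w(3)[OF that] by blast
  qed
  moreover have "\<beta> UNIV \<le> measure N (space N)"
    using x(4)[of J] spaces(3) by (simp add: \<beta>_def)
  moreover have "measure N (space N) - c \<le> \<beta> (space M \<times> space N)"
    using x(5) by (simp add: \<beta>_Times spaces)
  moreover have "\<beta> (A \<times> B) = 0" if AB: "A \<in> F" "B \<in> G" "(A \<times> B) \<inter> S = {}" for A B
    unfolding \<beta>_Times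
    by (rule sum_eq_0_if_rectangle_avoids[OF _ AB(3), of x F G])
       (use x(2) z(2) w(2) AB(1,2) in \<open>auto simp: f_def g_def\<close>)
  ultimately show thesis
    by (intro that[of \<beta>]) (simp add: partial_coupling_charge_def)
qed

lemma partial_coupling_charge_antimono:
  assumes "partial_coupling_charge F G S c M N \<beta>" "F' \<subseteq> F" "G' \<subseteq> G"
  shows "partial_coupling_charge F' G' S c M N \<beta>"
  using assms by (simp add: partial_coupling_charge_def marginals_le_on_def subset_iff)

lemma partial_coupling_chargeI_singletons:
  assumes "F \<noteq> {}" "G \<noteq> {}"
    and "\<And>A B. A \<in> F \<Longrightarrow> B \<in> G \<Longrightarrow> partial_coupling_charge {A} {B} S c M N \<beta>"
  shows "partial_coupling_charge F G S c M N \<beta>"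
proof -
  obtain A\<^sub>0 B\<^sub>0 where "A\<^sub>0 \<in> F" "B\<^sub>0 \<in> G"
    using assms(1,2) by auto
  then show ?thesis
    using assms(3)[OF _ \<open>B\<^sub>0 \<in> G\<close>] assms(3)[OF \<open>A\<^sub>0 \<in> F\<close>] assms(3)
    by (simp add: partial_coupling_charge_def marginals_le_on_def)
qed

lemma closed_partial_coupling_charges:
  "closed {\<beta>. partial_coupling_charge F G S c M N \<beta>}"
  unfolding partial_coupling_charge_def positive_charge_def marginals_le_on_def Ball_def
  by (intro closed_Collect_conj closed_Collect_all closed_Collect_imp open_Collect_const
      closed_Collect_le closed_Collect_eq continuous_intros continuous_on_product_coordinates)

theorem ex_partial_coupling_charge:
  assumes "finite_measure M" "finite_measure N" "strassen_condition S c M N"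
  obtains \<beta> where "partial_coupling_charge (sets M) (sets N) S c M N \<beta>"
proof -
  define X where "X = Pi UNIV (\<lambda>_ :: ('a \<times> 'b) set. {0..measure N (space N)})"
  define C where "C R = {\<beta>. partial_coupling_charge {fst R} {snd R} S c M N \<beta>}" for R
  have "X \<inter> (\<Inter>R\<in>sets M \<times> sets N. C R) \<noteq> {}"
  proof (rule compact_imp_fip_image)
    show "compact X"
      unfolding X_def by (intro compact_Pi_UNIV) simp
    show "closed (C R)" for R
      unfolding C_def by (rule closed_partial_coupling_charges)
    fix \<R> assume "finite \<R>" "\<R> \<subseteq> sets M \<times> sets N"
    then have "finite (fst ` \<R>)" "fst ` \<R> \<subseteq> sets M" "finite (snd ` \<R>)" "snd ` \<R> \<subseteq> sets N"
      by auto
    then obtain \<beta> where \<beta>: "partial_coupling_charge (fst ` \<R>) (snd ` \<R>) S c M N \<beta>"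
      by (rule ex_partial_coupling_charge_on_finite_families[OF assms])
    then have charge: "positive_charge \<beta>" and "\<beta> UNIV \<le> measure N (space N)"
      by (simp_all add: partial_coupling_charge_def)
    then have "\<beta> R \<le> measure N (space N)" for R
      using positive_charge_mono[OF charge subset_UNIV, of R] by linarith
    then have "\<beta> \<in> X"
      using positive_charge_nonneg[OF charge] by (simp add: X_def)
    moreover have "\<beta> \<in> C R" if "R \<in> \<R>" for R
      using partial_coupling_charge_antimono[OF \<beta>] that by (simp add: C_def)
    ultimately show "X \<inter> (\<Inter>R\<in>\<R>. C R) \<noteq> {}"
      by blast
  qed
  then obtain \<beta> where \<beta>: "\<And>R. R \<in> sets M \<times> sets N \<Longrightarrow> \<beta> \<in> C R"
    by blast
  have "partial_coupling_charge (sets M) (sets N) S c M N \<beta>"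
  proof (rule partial_coupling_chargeI_singletons)
    show "partial_coupling_charge {A} {B} S c M N \<beta>" if "A \<in> sets M" "B \<in> sets N" for A B
      using \<beta>[of "(A, B)"] that by (simp add: C_def)
  qed blast+
  then show thesis
    by (rule that)
qed

section \<open>Extension of a charge to a Borel measure\<close>

lemma finite_borel_measureD:
  assumes "finite_borel_measure M"
  shows "finite_measure M" "sets M = sets borel" "space M = UNIV"
  using assms sets_eq_imp_space_eq[of M borel] by (auto simp: finite_borel_measure_def)

lemma compact_inner_approx:
  fixes M :: "'a::polish_space measure"
  assumes M: "finite_borel_measure M" and A: "A \<in> sets borel" and e: "0 < e"
  obtains K where "compact K" "K \<subseteq> A" "measure M (A - K) \<le> e"
proof -
  note M' = finite_borel_measureD[OF M]
  interpret finite_measure M by fact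
  have "emeasure M A = (SUP K\<in>{K. K \<subseteq> A \<and> compact K}. emeasure M K)"
    using M' A by (intro inner_regular) auto
  moreover have "{} \<in> {K. K \<subseteq> A \<and> compact K}"
    by simp
  ultimately have "\<exists>K\<in>{K. K \<subseteq> A \<and> compact K}. emeasure M A < emeasure M K + ennreal e"
    using emeasure_finite[of A] by (intro SUP_approx_ennreal[OF e]) auto
  then obtain K where K: "K \<subseteq> A" "compact K" "emeasure M A < emeasure M K + ennreal e"
    by blast
  have "measure M (A - K) = measure M A - measure M K"
    using A K(1,2) M' by (intro finite_measure_Diff) (auto simp: borel_compact)
  moreover have "measure M A \<le> measure M K + e"
    using K(3) e by (simp add: emeasure_eq_measure ennreal_less_iff flip: ennreal_plus)
  ultimately show thesis
    using K(1,2) by (intro that[of K]) auto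
qed

lemma open_outer_approx:
  fixes M :: "'a::polish_space measure"
  assumes M: "finite_borel_measure M" and A: "A \<in> sets borel" and e: "0 < e"
  obtains U where "open U" "A \<subseteq> U" "measure M (U - A) \<le> e"
proof -
  have "- A \<in> sets borel"
    using A by auto
  then obtain K where K: "compact K" "K \<subseteq> - A" "measure M (- A - K) \<le> e"
    using compact_inner_approx[OF M _ e] by blast
  moreover have "- K - A = - A - K"
    by auto
  ultimately show thesis
    using compact_imp_closed by (intro that[of "- K"]) auto
qed

lemma semiring_of_sets_rectangles:
  "semiring_of_sets (space M \<times> space N) {A \<times> B | A B. A \<in> sets M \<and> B \<in> sets N}" (is "semiring_of_sets _ ?\<R>")
proof
  have rectangle: "A \<times> B \<in> ?\<R>" if "A \<in> sets M" "B \<in> sets N" for A B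
    using that by blast
  show "?\<R> \<subseteq> Pow (space M \<times> space N)"
    by (auto dest: sets.sets_into_space)
  show "{} \<in> ?\<R>"
    using rectangle[OF sets.empty_sets sets.empty_sets] by simp
  fix R T assume "R \<in> ?\<R>" "T \<in> ?\<R>"
  then obtain A B C D where sets: "A \<in> sets M" "B \<in> sets N" "C \<in> sets M" "D \<in> sets N"
    and R: "R = A \<times> B" and T: "T = C \<times> D"
    by auto
  show "R \<inter> T \<in> ?\<R>"
    using rectangle[of "A \<inter> C" "B \<inter> D"] sets by (simp add: R T Times_Int_Times)
  let ?\<C> = "{(A - C) \<times> B, (A \<inter> C) \<times> (B - D)}"
  have "?\<C> \<subseteq> ?\<R>"
    using rectangle sets by simp
  moreover have "R - T = \<Union>?\<C>"
    by (auto simp: R T)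
  moreover have "disjnt ((A - C) \<times> B) ((A \<inter> C) \<times> (B - D))"
    by (auto simp: disjnt_def)
  then have "disjoint ?\<C>"
    by (simp add: pairwise_insert disjnt_sym)
  ultimately show "\<exists>\<C>\<subseteq>?\<R>. finite \<C> \<and> disjoint \<C> \<and> R - T = \<Union>\<C>"
    by (intro exI[of _ ?\<C>]) simp
qed

lemma positive_charge_Times_le:
  assumes \<beta>: "positive_charge \<beta>" "marginals_le_on (sets M) (sets N) \<beta> M N"
    and A: "A \<in> sets M" "A' \<in> sets M" and B: "B \<in> sets N" "B' \<in> sets N"
  shows "\<beta> (A \<times> B) \<le> \<beta> (A' \<times> B') + measure M (A - A') + measure N (B - B')"
proof -
  have "A \<subseteq> space M" "B \<subseteq> space N"
    using A B by (auto dest: sets.sets_into_space)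
  then have "\<beta> (A \<times> B) \<le> \<beta> (A' \<times> B' \<union> (A - A') \<times> space N \<union> space M \<times> (B - B'))"
    by (intro positive_charge_mono[OF \<beta>(1)]) auto
  also have "\<dots> \<le> \<beta> (A' \<times> B' \<union> (A - A') \<times> space N) + \<beta> (space M \<times> (B - B'))"
    by (rule positive_charge_subadditive[OF \<beta>(1)])
  also have "\<dots> \<le> (\<beta> (A' \<times> B') + \<beta> ((A - A') \<times> space N)) + \<beta> (space M \<times> (B - B'))"
    by (intro add_right_mono positive_charge_subadditive[OF \<beta>(1)])
  also have "\<dots> \<le> \<beta> (A' \<times> B') + measure M (A - A') + measure N (B - B')"
    using \<beta>(2) A B by (intro add_mono) (auto simp: marginals_le_on_def)
  finally show ?thesis .
qed

lemma sets_borel_prod_eq_sigma_sets: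
  "sets (borel :: ('a::second_countable_topology \<times> 'b::second_countable_topology) measure)
    = sigma_sets UNIV {A \<times> B | A B. A \<in> sets borel \<and> B \<in> sets borel}"
  unfolding borel_prod[symmetric] sets_pair_measure by simp

lemma sum_power_half_le_1: "(\<Sum>i<n. (1/2 :: real) ^ Suc i) \<le> 1"
  by (subst sums_unique[OF power_half_series])
     (intro sum_le_suminf sums_summable[OF power_half_series], auto)

context
  fixes \<mu> :: "'a::polish_space measure" and \<nu> :: "'b::polish_space measure" and \<beta> :: "('a \<times> 'b) set \<Rightarrow> real"
  assumes \<mu>: "finite_borel_measure \<mu>" and \<nu>: "finite_borel_measure \<nu>"
    and \<beta>: "positive_charge \<beta>" "marginals_le_on (sets \<mu>) (sets \<nu>) \<beta> \<mu> \<nu>"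
begin

lemma charge_compact_rectangle_inner:
  assumes "A \<in> sets borel" "B \<in> sets borel" "0 < e"
  obtains K L where "compact K" "compact L" "K \<subseteq> A" "L \<subseteq> B" "\<beta> (A \<times> B) \<le> \<beta> (K \<times> L) + e"
proof -
  obtain K where K: "compact K" "K \<subseteq> A" "measure \<mu> (A - K) \<le> e / 2"
    by (rule compact_inner_approx[OF \<mu> assms(1) half_gt_zero[OF assms(3)]])
  obtain L where L: "compact L" "L \<subseteq> B" "measure \<nu> (B - L) \<le> e / 2"
    by (rule compact_inner_approx[OF \<nu> assms(2) half_gt_zero[OF assms(3)]])
  have "\<beta> (A \<times> B) \<le> \<beta> (K \<times> L) + measure \<mu> (A - K) + measure \<nu> (B - L)"
    using assms K(1) L(1) finite_borel_measureD(2)[OF \<mu>] finite_borel_measureD(2)[OF \<nu>]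
    by (intro positive_charge_Times_le[OF \<beta>]) (auto simp: borel_compact)
  with K L show thesis
    by (intro that[of K L]) auto
qed

lemma charge_open_rectangle_outer:
  assumes "A \<in> sets borel" "B \<in> sets borel" "0 < e"
  obtains U V where "open U" "open V" "A \<subseteq> U" "B \<subseteq> V" "\<beta> (U \<times> V) \<le> \<beta> (A \<times> B) + e"
proof -
  obtain U where U: "open U" "A \<subseteq> U" "measure \<mu> (U - A) \<le> e / 2"
    by (rule open_outer_approx[OF \<mu> assms(1) half_gt_zero[OF assms(3)]])
  obtain V where V: "open V" "B \<subseteq> V" "measure \<nu> (V - B) \<le> e / 2"
    by (rule open_outer_approx[OF \<nu> assms(2) half_gt_zero[OF assms(3)]])
  have "\<beta> (U \<times> V) \<le> \<beta> (A \<times> B) + measure \<mu> (U - A) + measure \<nu> (V - B)"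
    using assms U(1) V(1) finite_borel_measureD(2)[OF \<mu>] finite_borel_measureD(2)[OF \<nu>]
    by (intro positive_charge_Times_le[OF \<beta>]) auto
  with U V show thesis
    by (intro that[of U V]) auto
qed

lemma charge_finite_rectangle_cover:
  assumes AB: "A \<in> sets borel" "B \<in> sets borel"
    and CD: "\<And>i :: nat. C i \<in> sets borel" "\<And>i. D i \<in> sets borel" "A \<times> B \<subseteq> (\<Union>i. C i \<times> D i)"
    and e: "0 < e"
  obtains n where "\<beta> (A \<times> B) \<le> (\<Sum>i<n. \<beta> (C i \<times> D i)) + e"
proof -
  obtain K L where KL: "compact K" "compact L" "K \<subseteq> A" "L \<subseteq> B" "\<beta> (A \<times> B) \<le> \<beta> (K \<times> L) + e / 2"
    by (rule charge_compact_rectangle_inner[OF AB half_gt_zero[OF e]])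
  have "\<exists>U V. open U \<and> open V \<and> C i \<subseteq> U \<and> D i \<subseteq> V
      \<and> \<beta> (U \<times> V) \<le> \<beta> (C i \<times> D i) + e / 2 * (1/2) ^ Suc i" for i
  proof -
    have "0 < e / 2 * (1/2) ^ Suc i"
      using e by simp
    then show ?thesis
      using charge_open_rectangle_outer[OF CD(1)[of i] CD(2)[of i]] by metis
  qed
  then obtain U V where UV: "\<And>i. open (U i)" "\<And>i. open (V i)" "\<And>i. C i \<subseteq> U i" "\<And>i. D i \<subseteq> V i"
    "\<And>i. \<beta> (U i \<times> V i) \<le> \<beta> (C i \<times> D i) + e / 2 * (1/2) ^ Suc i"
    by metis
  have "K \<times> L \<subseteq> A \<times> B"
    using KL(3,4) by auto
  also note CD(3)
  also have "(\<Union>i. C i \<times> D i) \<subseteq> (\<Union>i. U i \<times> V i)"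
    by (intro UN_mono Sigma_mono UV subset_refl)
  finally obtain I where I: "finite I" "K \<times> L \<subseteq> (\<Union>i\<in>I. U i \<times> V i)"
    by (rule compactE_image[OF compact_Times[OF KL(1,2)] open_Times[OF UV(1,2)]])
  then obtain n where "I \<subseteq> {..<n}"
    by (auto simp: finite_nat_iff_bounded)
  then have "(\<Union>i\<in>I. U i \<times> V i) \<subseteq> (\<Union>i<n. U i \<times> V i)"
    by (intro UN_mono) auto
  with I(2) have "\<beta> (K \<times> L) \<le> \<beta> (\<Union>i<n. U i \<times> V i)"
    by (intro positive_charge_mono[OF \<beta>(1)]) auto
  also have "\<dots> \<le> (\<Sum>i<n. \<beta> (U i \<times> V i))"
    by (intro positive_charge_UN_le[OF \<beta>(1)]) simp
  also have "\<dots> \<le> (\<Sum>i<n. \<beta> (C i \<times> D i) + e / 2 * (1/2) ^ Suc i)"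
    by (intro sum_mono UV(5))
  also have "\<dots> = (\<Sum>i<n. \<beta> (C i \<times> D i)) + e / 2 * (\<Sum>i<n. (1/2) ^ Suc i)"
    by (simp only: sum.distrib sum_distrib_left)
  also note sum_power_half_le_1
  finally have "\<beta> (K \<times> L) \<le> (\<Sum>i<n. \<beta> (C i \<times> D i)) + e / 2"
    using e by simp
  with KL(5) have "\<beta> (A \<times> B) \<le> (\<Sum>i<n. \<beta> (C i \<times> D i)) + e"
    by linarith
  then show thesis
    by (rule that)
qed

lemma countably_additive_charge_on_rectangles:
  shows "countably_additive {A \<times> B | A B. A \<in> sets borel \<and> B \<in> sets borel} (\<lambda>R. ennreal (\<beta> R))"
proof (rule countably_additiveI, rule antisym)
  let ?\<R> = "{A \<times> B | A B. A \<in> sets borel \<and> B \<in> sets borel} :: ('a \<times> 'b) set set"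
  fix R :: "nat \<Rightarrow> ('a \<times> 'b) set"
  assume R: "range R \<subseteq> ?\<R>" "disjoint_family R" "(\<Union>i. R i) \<in> ?\<R>"
  show "(\<Sum>i. ennreal (\<beta> (R i))) \<le> ennreal (\<beta> (\<Union>i. R i))"
  proof (rule suminf_le_const[OF summableI])
    fix n
    have "(\<Sum>i<n. \<beta> (R i)) = \<beta> (\<Union>i<n. R i)"
      using disjoint_family_on_mono[OF subset_UNIV R(2)]
      by (intro positive_charge_UN_disjoint[OF \<beta>(1), symmetric]) auto
    also have "\<dots> \<le> \<beta> (\<Union>i. R i)"
      by (intro positive_charge_mono[OF \<beta>(1)]) auto
    finally show "(\<Sum>i<n. ennreal (\<beta> (R i))) \<le> ennreal (\<beta> (\<Union>i. R i))"
      by (simp add: sum_ennreal positive_charge_nonneg[OF \<beta>(1)] ennreal_leI)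
  qed
  have "R i \<in> ?\<R>" for i
    using R(1) by (rule subsetD) (rule rangeI)
  then obtain C D where CD: "\<And>i. R i = C i \<times> D i" "\<And>i. C i \<in> sets borel" "\<And>i. D i \<in> sets borel"
    unfolding mem_Collect_eq by metis
  obtain A B where AB: "(\<Union>i. R i) = A \<times> B" "A \<in> sets borel" "B \<in> sets borel"
    using R(3) by auto
  show "ennreal (\<beta> (\<Union>i. R i)) \<le> (\<Sum>i. ennreal (\<beta> (R i)))"
  proof (rule ennreal_le_epsilon)
    fix e :: real assume e: "0 < e"
    have "A \<times> B \<subseteq> (\<Union>i. C i \<times> D i)"
      using AB(1) CD(1) by auto
    then obtain n where "\<beta> (A \<times> B) \<le> (\<Sum>i<n. \<beta> (C i \<times> D i)) + e"
      by (rule charge_finite_rectangle_cover[OF AB(2,3) CD(2,3) _ e])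
    then have "ennreal (\<beta> (\<Union>i. R i)) \<le> ennreal ((\<Sum>i<n. \<beta> (R i)) + e)"
      unfolding AB(1) CD(1)[symmetric] by (rule ennreal_leI)
    also have "\<dots> = (\<Sum>i<n. ennreal (\<beta> (R i))) + ennreal e"
      using e by (simp add: sum_ennreal positive_charge_nonneg[OF \<beta>(1)] sum_nonneg)
    also have "\<dots> \<le> (\<Sum>i. ennreal (\<beta> (R i))) + ennreal e"
      by (intro add_right_mono sum_le_suminf summableI) auto
    finally show "ennreal (\<beta> (\<Union>i. R i)) \<le> (\<Sum>i. ennreal (\<beta> (R i))) + ennreal e" .
  qed
qed

theorem charge_extends_to_borel_measure:
  obtains \<gamma> where "finite_borel_measure \<gamma>"
    "\<And>A B. A \<in> sets borel \<Longrightarrow> B \<in> sets borel \<Longrightarrow> measure \<gamma> (A \<times> B) = \<beta> (A \<times> B)"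
proof -
  let ?\<R> = "{A \<times> B | A B. A \<in> sets borel \<and> B \<in> sets borel} :: ('a \<times> 'b) set set"
  interpret semiring_of_sets UNIV ?\<R>
    using semiring_of_sets_rectangles[of borel borel] by simp
  have "positive ?\<R> (\<lambda>R. ennreal (\<beta> R))"
    by (simp add: positive_def positive_charge_empty[OF \<beta>(1)])
  then obtain m where m: "\<And>R. R \<in> ?\<R> \<Longrightarrow> m R = ennreal (\<beta> R)"
    "measure_space UNIV (sets borel) m"
    unfolding sets_borel_prod_eq_sigma_sets
    using caratheodory countably_additive_charge_on_rectangles by blast
  define \<gamma> where "\<gamma> = measure_of UNIV (sets borel) m"
  have sets: "sets \<gamma> = sets borel"
    by (simp add: \<gamma>_def sets.sigma_sets_eq[of borel, simplified])
  have rect: "emeasure \<gamma> (A \<times> B) = ennreal (\<beta> (A \<times> B))" if "A \<in> sets borel" "B \<in> sets borel" for A B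
  proof -
    have "A \<times> B \<in> sets borel"
      using that by (rule borel_Times)
    then have "emeasure \<gamma> (A \<times> B) = m (A \<times> B)"
      using m(2) unfolding \<gamma>_def measure_space_def by (intro emeasure_measure_of_sigma) auto
    then show ?thesis
      using m(1)[of "A \<times> B"] that by auto
  qed
  show thesis
  proof
    have "finite_measure \<gamma>"
      using rect[of UNIV UNIV] by (intro finite_measureI) (simp add: \<gamma>_def space_measure_of_conv)
    then show "finite_borel_measure \<gamma>"
      by (simp add: finite_borel_measure_def sets)
    show "measure \<gamma> (A \<times> B) = \<beta> (A \<times> B)" if "A \<in> sets borel" "B \<in> sets borel" for A B
      using rect[OF that] positive_charge_nonneg[OF \<beta>(1)] by (simp add: measure_def)
  qed
qed

end

lemma Union_open_null:
  fixes M :: "'a::second_countable_topology measure"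
  assumes "\<And>U. U \<in> \<U> \<Longrightarrow> open U" "\<And>U. U \<in> \<U> \<Longrightarrow> U \<in> null_sets M"
  shows "\<Union>\<U> \<in> null_sets M"
proof -
  obtain \<V> where \<V>: "\<V> \<subseteq> \<U>" "countable \<V>" "\<Union>\<V> = \<Union>\<U>"
    using Lindelof assms(1) by metis
  then have "(\<Union>U\<in>\<V>. U) \<in> null_sets M"
    using assms(2) by (intro null_sets_UN') auto
  then show ?thesis
    using \<V>(3) by simp
qed

lemma open_null_if_rectangles_null:
  fixes \<gamma> :: "('a::second_countable_topology \<times> 'b::second_countable_topology) measure"
  assumes "open W"
    and "\<And>A B. open A \<Longrightarrow> open B \<Longrightarrow> A \<times> B \<subseteq> W \<Longrightarrow> A \<times> B \<in> null_sets \<gamma>"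
  shows "W \<in> null_sets \<gamma>"
proof -
  have "W \<subseteq> \<Union>{A \<times> B | A B. open A \<and> open B \<and> A \<times> B \<subseteq> W}"
  proof
    fix p assume "p \<in> W"
    then obtain A B where "open A" "open B" "p \<in> A \<times> B" "A \<times> B \<subseteq> W"
      by (rule open_prod_elim[OF assms(1)])
    then show "p \<in> \<Union>{A \<times> B | A B. open A \<and> open B \<and> A \<times> B \<subseteq> W}"
      by blast
  qed
  then have "W = \<Union>{A \<times> B | A B. open A \<and> open B \<and> A \<times> B \<subseteq> W}"
    by blast
  moreover have "\<Union>{A \<times> B | A B. open A \<and> open B \<and> A \<times> B \<subseteq> W} \<in> null_sets \<gamma>"
    using assms(2) by (intro Union_open_null) (auto intro: open_Times)
  ultimately show ?thesis
    by simp
qed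

lemma strassen_condition_compactI:
  fixes \<mu> :: "'a::topological_space measure" and \<nu> :: "'b::polish_space measure"
  assumes \<mu>: "finite_borel_measure \<mu>" and \<nu>: "finite_borel_measure \<nu>"
    and compact: "\<And>K U. compact K \<Longrightarrow> U \<in> sets borel \<Longrightarrow> S\<inverse> `` K \<subseteq> U \<Longrightarrow> measure \<nu> K \<le> measure \<mu> U + c"
  shows "strassen_condition S c \<mu> \<nu>"
  unfolding strassen_condition_def
proof (intro ballI impI, rule field_le_epsilon)
  note \<mu>' = finite_borel_measureD[OF \<mu>] and \<nu>' = finite_borel_measureD[OF \<nu>]
  interpret \<nu>: finite_measure \<nu> by fact
  fix B U and e :: real
  assume B: "B \<in> sets \<nu>" and U: "U \<in> sets \<mu>" "S\<inverse> `` B \<inter> space \<mu> \<subseteq> U" and "0 < e"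
  then obtain K where K: "compact K" "K \<subseteq> B" "measure \<nu> (B - K) \<le> e"
    using compact_inner_approx[OF \<nu>, of B e] by (auto simp: \<nu>')
  have "measure \<nu> (B - K) = measure \<nu> B - measure \<nu> K"
    using B K by (intro \<nu>.finite_measure_Diff) (auto simp: \<nu>' borel_compact)
  moreover have "measure \<nu> K \<le> measure \<mu> U + c"
    using U K(2) by (intro compact[OF K(1)]) (auto simp: \<mu>')
  ultimately show "measure \<nu> B \<le> measure \<mu> U + c + e"
    using K(3) by linarith
qed

theorem strassen_partial_coupling:
  fixes \<mu> :: "'a::polish_space measure" and \<nu> :: "'b::polish_space measure"
  assumes \<mu>: "finite_borel_measure \<mu>" and \<nu>: "finite_borel_measure \<nu>"
    and S: "closed S" "strassen_condition S c \<mu> \<nu>"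
  obtains \<gamma> where "finite_borel_measure \<gamma>" "marginals_le_on (sets \<mu>) (sets \<nu>) (measure \<gamma>) \<mu> \<nu>"
    "measure \<gamma> (- S) = 0" "measure \<nu> UNIV - c \<le> measure \<gamma> UNIV"
proof -
  note \<mu>' = finite_borel_measureD[OF \<mu>] and \<nu>' = finite_borel_measureD[OF \<nu>]
  obtain \<beta> where \<beta>: "partial_coupling_charge (sets \<mu>) (sets \<nu>) S c \<mu> \<nu> \<beta>"
    by (rule ex_partial_coupling_charge[OF \<mu>'(1) \<nu>'(1) S(2)])
  then have charge: "positive_charge \<beta>" "marginals_le_on (sets \<mu>) (sets \<nu>) \<beta> \<mu> \<nu>"
    and off_S: "\<And>A B. A \<in> sets borel \<Longrightarrow> B \<in> sets borel \<Longrightarrow> (A \<times> B) \<inter> S = {} \<Longrightarrow> \<beta> (A \<times> B) = 0"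
    and mass: "measure \<nu> UNIV - c \<le> \<beta> UNIV"
    by (simp_all add: partial_coupling_charge_def \<mu>' \<nu>')
  obtain \<gamma> where \<gamma>: "finite_borel_measure \<gamma>"
    "\<And>A B. A \<in> sets borel \<Longrightarrow> B \<in> sets borel \<Longrightarrow> measure \<gamma> (A \<times> B) = \<beta> (A \<times> B)"
    using charge_extends_to_borel_measure[OF \<mu> \<nu> charge] by metis
  note \<gamma>' = finite_borel_measureD[OF \<gamma>(1)]
  interpret \<gamma>: finite_measure \<gamma> by fact
  have "- S \<in> null_sets \<gamma>"
  proof (rule open_null_if_rectangles_null)
    show "open (- S)"
      using S(1) by (simp add: open_Compl)
    fix A B assume AB: "open A" "open B" "A \<times> B \<subseteq> - S"
    then have "measure \<gamma> (A \<times> B) = 0"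
      using off_S[of A B] \<gamma>(2) by auto
    then show "A \<times> B \<in> null_sets \<gamma>"
      using AB by (simp add: null_sets_def \<gamma>' borel_Times \<gamma>.emeasure_eq_measure)
  qed
  moreover have "marginals_le_on (sets \<mu>) (sets \<nu>) (measure \<gamma>) \<mu> \<nu>"
    using charge(2) \<gamma>(2) by (simp add: marginals_le_on_def \<mu>' \<nu>')
  moreover have "measure \<nu> UNIV - c \<le> measure \<gamma> UNIV"
    using mass \<gamma>(2)[of UNIV UNIV] by simp
  ultimately show thesis
    using \<gamma>(1) by (intro that[of \<gamma>]) (simp_all add: measure_def null_setsD1)
qed

section \<open>Projections of closed sets\<close>

lemma convergent_subseq_if_totally_bounded:
  fixes y :: "nat \<Rightarrow> 'b::complete_space"
  assumes "\<And>e. 0 < e \<Longrightarrow> \<exists>n T. finite T \<and> y ` {n..} \<subseteq> (\<Union>c\<in>T. cball c e)"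
  obtains l r where "strict_mono r" "(y \<circ> r) \<longlonglongrightarrow> l"
proof -
  let ?Y = "closure (range y)"
  have "compact ?Y"
    unfolding compact_eq_totally_bounded
  proof (intro conjI allI impI)
    show "complete ?Y"
      by (simp add: complete_eq_closed)
    fix e :: real assume "0 < e"
    then obtain n T where T: "finite T" "y ` {n..} \<subseteq> (\<Union>c\<in>T. cball c (e / 2))"
      using assms half_gt_zero by metis
    let ?T = "T \<union> y ` {..<n}"
    have "y k \<in> (\<Union>c\<in>?T. cball c (e / 2))" for k
    proof (cases "k < n")
      case True
      then show ?thesis
        using \<open>0 < e\<close> by (intro UN_I[of "y k"]) auto
    next
      case False
      then have "y k \<in> (\<Union>c\<in>T. cball c (e / 2))"
        by (intro subsetD[OF T(2)] imageI) simp
      then show ?thesis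
        by auto
    qed
    then have "range y \<subseteq> (\<Union>c\<in>?T. cball c (e / 2))"
      by blast
    then have "?Y \<subseteq> (\<Union>c\<in>?T. cball c (e / 2))"
      using T(1) by (intro closure_minimal closed_UN) simp_all
    also have "\<dots> \<subseteq> (\<Union>c\<in>?T. ball c e)"
      using \<open>0 < e\<close> by (intro UN_mono) auto
    finally show "\<exists>T. finite T \<and> ?Y \<subseteq> (\<Union>c\<in>T. ball c e)"
      using T(1) by (intro exI[of _ ?T]) simp
  qed
  moreover have "y k \<in> ?Y" for k
    using closure_subset by (rule subsetD) simp
  ultimately obtain l r where "strict_mono r" "(y \<circ> r) \<longlonglongrightarrow> l"
    unfolding compact_def by metis
  then show thesis
    by (rule that)
qed

lemma INT_closure_fst_subset_if_totally_bounded: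
  fixes F :: "('a::metric_space \<times> 'b::complete_space) set"
  assumes F: "closed F" and L: "decseq L" "\<And>n. L n \<subseteq> F"
    and totally_bounded: "\<And>e. 0 < e \<Longrightarrow> \<exists>n T. finite T \<and> snd ` L n \<subseteq> (\<Union>c\<in>T. cball c e)"
  shows "(\<Inter>n. closure (fst ` L n)) \<subseteq> fst ` F"
proof
  fix x assume x: "x \<in> (\<Inter>n. closure (fst ` L n))"
  have "\<exists>p\<in>L n. dist (fst p) x < (1/2) ^ n" for n
  proof -
    have "x \<in> closure (fst ` L n)" "0 < (1/2 :: real) ^ n"
      using x by auto
    then show ?thesis
      unfolding closure_approachable by blast
  qed
  then obtain p where p: "\<And>n. p n \<in> L n" "\<And>n. dist (fst (p n)) x < (1/2) ^ n"
    by metis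
  have "\<exists>n T. finite T \<and> (\<lambda>n. snd (p n)) ` {n..} \<subseteq> (\<Union>c\<in>T. cball c e)" if e: "0 < e" for e
  proof -
    obtain n T where T: "finite T" "snd ` L n \<subseteq> (\<Union>c\<in>T. cball c e)"
      using totally_bounded[OF e] by blast
    have "(\<lambda>n. snd (p n)) ` {n..} \<subseteq> snd ` L n"
      using p(1) decseqD[OF L(1)] by blast
    with T show ?thesis
      by (intro exI[of _ n] exI[of _ T]) (auto intro: subset_trans)
  qed
  then obtain y r where r: "strict_mono r" "((\<lambda>n. snd (p n)) \<circ> r) \<longlonglongrightarrow> y"
    by (rule convergent_subseq_if_totally_bounded)
  have "(\<lambda>n. (1/2 :: real) ^ n) \<longlonglongrightarrow> 0"
    by (intro LIMSEQ_power_zero) simp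
  then have "(\<lambda>n. fst (p n)) \<longlonglongrightarrow> x"
    by (rule metric_tendsto_imp_tendsto) (use p(2) in \<open>auto intro!: always_eventually less_imp_le\<close>)
  then have "((\<lambda>n. fst (p n)) \<circ> r) \<longlonglongrightarrow> x"
    using r(1) by (rule LIMSEQ_subseq_LIMSEQ)
  from tendsto_Pair[OF this r(2)] have "(\<lambda>n. p (r n)) \<longlonglongrightarrow> (x, y)"
    by simp
  moreover have "p (r n) \<in> F" for n
    using p(1) L(2) by (rule subsetD[rotated])
  ultimately have "(x, y) \<in> F"
    using closed_sequentially[OF F, of "\<lambda>n. p (r n)"] by simp
  then show "x \<in> fst ` F"
    by force
qed

text \<open>Cutting the second coordinate down to finitely many balls of radius \<open>2\<^sup>-\<^sup>n\<close>, for every \<open>n\<close>, costs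
  arbitrarily little outer measure of the projection and makes the second coordinate totally bounded.\<close>

lemma outer_measure_fst_cut_to_finite_cballs:
  fixes R :: "('a \<times> 'b::{metric_space,second_countable_topology}) set"
  assumes R: "fst ` R \<subseteq> space M" "t < outer_measure_of M (fst ` R)" and "0 < r"
  obtains T where "finite T" "t < outer_measure_of M (fst ` (R \<inter> UNIV \<times> (\<Union>c\<in>T. cball c r)))"
proof -
  obtain D :: "'b set" where D: "countable D" "\<And>X. open X \<Longrightarrow> X \<noteq> {} \<Longrightarrow> \<exists>d\<in>D. d \<in> X"
    by (rule countable_dense_setE) (rule that)
  then have "D \<noteq> {}"
    using open_UNIV by blast
  then have D_range: "range (from_nat_into D) = D"
    using D(1) by (rule range_from_nat_into)
  define V where "V m = (\<Union>c\<in>from_nat_into D ` {..m}. cball c r)" for m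
  have "y \<in> (\<Union>m. V m)" for y
  proof -
    obtain d where "d \<in> D" "d \<in> ball y r"
      using D(2)[of "ball y r"] \<open>0 < r\<close> by auto
    moreover from this obtain m where "d = from_nat_into D m"
      using D_range by auto
    ultimately have "y \<in> V m"
      by (auto simp: V_def dist_commute intro!: bexI[of _ m])
    then show ?thesis
      by blast
  qed
  then have "R = (\<Union>m. R \<inter> UNIV \<times> V m)"
    by auto
  then have "fst ` R = (\<Union>m. fst ` (R \<inter> UNIV \<times> V m))"
    by (metis image_UN)
  moreover have "incseq (\<lambda>m. fst ` (R \<inter> UNIV \<times> V m))"
    unfolding V_def by (intro monoI image_mono Int_mono Sigma_mono UN_mono) auto
  moreover have "fst ` (R \<inter> UNIV \<times> V m) \<subseteq> space M" for m
    using R(1) by blast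
  ultimately have "t < (SUP m. outer_measure_of M (fst ` (R \<inter> UNIV \<times> V m)))"
    using R(2) by (simp add: SUP_outer_measure_of_incseq)
  then obtain m where "t < outer_measure_of M (fst ` (R \<inter> UNIV \<times> V m))"
    unfolding less_SUP_iff by blast
  then show thesis
    unfolding V_def by (intro that[of "from_nat_into D ` {..m}"]) simp_all
qed

lemma ex_totally_bounded_decseq:
  fixes F :: "('a \<times> 'b::{metric_space,second_countable_topology}) set"
  assumes F: "fst ` F \<subseteq> space M" "t < outer_measure_of M (fst ` F)"
  obtains L where "decseq L" "\<And>n. L n \<subseteq> F" "\<And>n. t < outer_measure_of M (fst ` L n)"
    "\<And>e. 0 < e \<Longrightarrow> \<exists>n T. finite T \<and> snd ` L n \<subseteq> (\<Union>c\<in>T. cball c e)"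
proof -
  have "\<exists>L. \<forall>n. (L n \<subseteq> F \<and> t < outer_measure_of M (fst ` L n))
      \<and> (\<exists>T. finite T \<and> L (Suc n) = L n \<inter> UNIV \<times> (\<Union>c\<in>T. cball c ((1/2) ^ n)))"
  proof (rule dependent_nat_choice)
    show "\<exists>R. R \<subseteq> F \<and> t < outer_measure_of M (fst ` R)"
      using F(2) by blast
    fix R n assume R: "R \<subseteq> F \<and> t < outer_measure_of M (fst ` R)"
    then have "fst ` R \<subseteq> space M" "t < outer_measure_of M (fst ` R)" "0 < (1/2 :: real) ^ n"
      using F(1) by auto
    then obtain T where "finite T"
      "t < outer_measure_of M (fst ` (R \<inter> UNIV \<times> (\<Union>c\<in>T. cball c ((1/2) ^ n))))"
      by (rule outer_measure_fst_cut_to_finite_cballs)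
    then show "\<exists>R'. (R' \<subseteq> F \<and> t < outer_measure_of M (fst ` R'))
        \<and> (\<exists>T. finite T \<and> R' = R \<inter> UNIV \<times> (\<Union>c\<in>T. cball c ((1/2) ^ n)))"
      using R by (intro exI[of _ "R \<inter> UNIV \<times> (\<Union>c\<in>T. cball c ((1/2) ^ n))"]) auto
  qed
  then obtain L T where L: "\<And>n. L n \<subseteq> F" "\<And>n. t < outer_measure_of M (fst ` L n)"
    and T: "\<And>n. finite (T n)" "\<And>n. L (Suc n) = L n \<inter> UNIV \<times> (\<Union>c\<in>T n. cball c ((1/2) ^ n))"
    by metis
  show thesis
  proof (rule that)
    show "decseq L"
      by (rule decseq_SucI) (simp add: T(2))
    fix e :: real assume "0 < e"
    then obtain n where n: "(1/2) ^ n < e"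
      using real_arch_pow_inv[of e "1/2"] by auto
    have "snd ` L (Suc n) \<subseteq> (\<Union>c\<in>T n. cball c ((1/2) ^ n))"
      by (auto simp: T(2))
    also have "\<dots> \<subseteq> (\<Union>c\<in>T n. cball c e)"
      using n by (intro UN_mono subset_cball) auto
    finally show "\<exists>n T. finite T \<and> snd ` L n \<subseteq> (\<Union>c\<in>T. cball c e)"
      using T(1) by blast
  qed (rule L)+
qed

lemma closed_subset_of_projection:
  fixes M :: "'a::metric_space measure" and F :: "('a \<times> 'b::polish_space) set"
  assumes M: "finite_borel_measure M" and F: "closed F" and t: "t < outer_measure_of M (fst ` F)"
  obtains K where "closed K" "K \<subseteq> fst ` F" "t \<le> emeasure M K"
proof -
  note M' = finite_borel_measureD[OF M]
  interpret finite_measure M by fact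
  obtain L where L: "decseq L" "\<And>n. L n \<subseteq> F" "\<And>n. t < outer_measure_of M (fst ` L n)"
    "\<And>e. 0 < e \<Longrightarrow> \<exists>n T. finite T \<and> snd ` L n \<subseteq> (\<Union>c\<in>T. cball c e)"
    by (rule ex_totally_bounded_decseq[OF _ t]) (simp add: M', rule that)
  have "t \<le> emeasure M (closure (fst ` L n))" for n
  proof -
    have "t \<le> outer_measure_of M (fst ` L n)"
      using L(3) by (rule less_imp_le)
    also have "\<dots> \<le> outer_measure_of M (closure (fst ` L n))"
      by (intro outer_measure_of_mono closure_subset)
    finally show ?thesis
      by (simp add: M')
  qed
  then have "t \<le> (INF n. emeasure M (closure (fst ` L n)))"
    by (rule INF_greatest)
  also have "\<dots> = emeasure M (\<Inter>n. closure (fst ` L n))"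
  proof (rule INF_emeasure_decseq)
    show "decseq (\<lambda>n. closure (fst ` L n))"
      using decseqD[OF L(1)] by (intro antimonoI closure_mono image_mono)
  qed (auto simp: M')
  finally show thesis
    using INT_closure_fst_subset_if_totally_bounded[OF F L(1,2,4)]
    by (intro that[of "\<Inter>n. closure (fst ` L n)"]) auto
qed

lemma (in finite_measure) sets_completionI_inner:
  assumes A: "A \<subseteq> space M"
    and inner: "\<And>t. t < outer_measure_of M A \<Longrightarrow> \<exists>K\<in>sets M. K \<subseteq> A \<and> t \<le> emeasure M K"
  shows "A \<in> sets (completion M)"
proof -
  obtain E where E: "E \<in> sets M" "A \<subseteq> E" "outer_measure_of M A = emeasure M E"
    using outer_measure_of_attain[OF A] by blast
  have "\<exists>K\<in>sets M. K \<subseteq> A \<and> measure M (E - K) \<le> 1 / Suc n" for n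
  proof (cases "measure M E = 0")
    case True
    then show ?thesis
      by (intro bexI[of _ "{}"]) auto
  next
    case False
    then have "ennreal (measure M E - 1 / Suc n) < outer_measure_of M A"
      unfolding E(3) emeasure_eq_measure by (intro ennreal_lessI) (auto simp: zero_less_measure_iff)
    then obtain K where K: "K \<in> sets M" "K \<subseteq> A" "ennreal (measure M E - 1 / Suc n) \<le> emeasure M K"
      using inner by blast
    have "measure M (E - K) = measure M E - measure M K"
      using E(1,2) K(1,2) by (intro finite_measure_Diff) auto
    also have "\<dots> \<le> 1 / Suc n"
      using K(3) by (simp add: emeasure_eq_measure)
    finally show ?thesis
      using K(1,2) by blast
  qed
  then obtain K where K: "\<And>n. K n \<in> sets M" "\<And>n. K n \<subseteq> A" "\<And>n. measure M (E - K n) \<le> 1 / Suc n"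
    by metis
  let ?S = "\<Union>n. K n"
  have "measure M (E - ?S) \<le> 1 / Suc n" for n
  proof -
    have "measure M (E - ?S) \<le> measure M (E - K n)"
      using E(1) K(1) by (intro finite_measure_mono) auto
    then show ?thesis
      using K(3) by (rule order_trans)
  qed
  then have "measure M (E - ?S) \<le> 0"
    using LIMSEQ_le_const[OF LIMSEQ_inverse_real_of_nat] by (simp add: inverse_eq_divide)
  then have null: "E - ?S \<in> null_sets M"
    using E(1) K(1) by (auto simp: null_sets_def emeasure_eq_measure measure_le_0_iff)
  have "A = ?S \<union> (A - ?S)" "A - ?S \<subseteq> E - ?S"
    using K(2) E(2) by auto
  moreover have "?S \<in> sets M"
    using K(1) by blast
  ultimately show ?thesis
    using null by (intro sets_completionI)
qed

lemma projection_in_sets_completion: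
  fixes M :: "'a::metric_space measure" and F :: "('a \<times> 'b::polish_space) set"
  assumes M: "finite_borel_measure M" and F: "closed F"
  shows "fst ` F \<in> sets (completion M)"
proof -
  note M' = finite_borel_measureD[OF M]
  interpret finite_measure M by fact
  show ?thesis
  proof (rule sets_completionI_inner)
    fix t assume "t < outer_measure_of M (fst ` F)"
    then obtain K where "closed K" "K \<subseteq> fst ` F" "t \<le> emeasure M K"
      by (rule closed_subset_of_projection[OF M F])
    then show "\<exists>K\<in>sets M. K \<subseteq> fst ` F \<and> t \<le> emeasure M K"
      by (intro bexI[of _ K]) (auto simp: M')
  qed (simp add: M')
qed

lemma cthick_in_sets_completion:
  fixes M :: "'a::polish_space measure"
  assumes "finite_borel_measure M" "closed A"
  shows "cthick A e \<in> sets (completion M)"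
proof -
  let ?F = "UNIV \<times> A \<inter> {p :: 'a \<times> 'a. dist (fst p) (snd p) \<le> e}"
  have "closed ?F"
    using assms(2) by (intro closed_Int closed_Times closed_Collect_le continuous_intros) auto
  moreover have "cthick A e = fst ` ?F"
    by (force simp: cthick_def)
  ultimately show ?thesis
    using projection_in_sets_completion[OF assms(1)] by simp
qed

section \<open>Completing a partial coupling\<close>

definition add_measure :: "'a measure \<Rightarrow> 'a measure \<Rightarrow> 'a measure" where
  "add_measure M N = measure_of (space M) (sets M) (\<lambda>A. emeasure M A + emeasure N A)"

lemma sets_add_measure [simp]: "sets (add_measure M N) = sets M"
  by (simp add: add_measure_def)

lemma space_add_measure [simp]: "space (add_measure M N) = space M"
  by (simp add: add_measure_def)

lemma emeasure_add_measure:
  assumes "sets N = sets M" "A \<in> sets M"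
  shows "emeasure (add_measure M N) A = emeasure M A + emeasure N A"
  unfolding add_measure_def
proof (rule emeasure_measure_of_sigma[OF sets.sigma_algebra_axioms _ _ assms(2)])
  let ?f = "\<lambda>A. emeasure M A + emeasure N A"
  show "positive (sets M) ?f"
    by (simp add: positive_def)
  show "countably_additive (sets M) ?f"
  proof (rule countably_additiveI)
    fix A :: "nat \<Rightarrow> 'a set" assume "range A \<subseteq> sets M" "disjoint_family A"
    then show "(\<Sum>i. ?f (A i)) = ?f (\<Union>i. A i)"
      using assms(1) by (subst suminf_add[symmetric]) (auto simp: suminf_emeasure)
  qed
qed

lemma finite_measure_add_measure:
  assumes "finite_measure M" "finite_measure N" "sets N = sets M"
  shows "finite_measure (add_measure M N)"
proof
  have "emeasure N (space M) \<noteq> \<infinity>"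
    using finite_measure.emeasure_finite[OF assms(2)] by simp
  then show "emeasure (add_measure M N) (space (add_measure M N)) \<noteq> \<infinity>"
    using finite_measure.emeasure_finite[OF assms(1), of "space M"]
    by (simp add: emeasure_add_measure assms(3))
qed

lemma measure_add_measure:
  assumes "finite_measure M" "finite_measure N" "sets N = sets M" "A \<in> sets M"
  shows "measure (add_measure M N) A = measure M A + measure N A"
  using finite_measure.emeasure_finite[OF assms(1)] finite_measure.emeasure_finite[OF assms(2)]
  by (simp add: measure_def emeasure_add_measure assms(3,4) enn2real_plus less_top)

lemma finite_measure_diff_measure:
  assumes "finite_measure M" "finite_measure N" "sets N = sets M"
    and le: "\<And>A. A \<in> sets M \<Longrightarrow> measure N A \<le> measure M A"
  shows "finite_measure (diff_measure M N)"
    and "A \<in> sets M \<Longrightarrow> measure (diff_measure M N) A = measure M A - measure N A"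
proof -
  interpret M: finite_measure M by fact
  interpret N: finite_measure N by fact
  have diff: "emeasure (diff_measure M N) A = ennreal (measure M A - measure N A)" if "A \<in> sets M" for A
  proof -
    have "emeasure (diff_measure M N) A = emeasure M A - emeasure N A"
      using assms that
      by (intro emeasure_diff_measure) (auto simp: M.emeasure_eq_measure N.emeasure_eq_measure ennreal_leI)
    then show ?thesis
      by (simp add: M.emeasure_eq_measure N.emeasure_eq_measure ennreal_minus)
  qed
  show "finite_measure (diff_measure M N)"
    by (rule finite_measureI) (simp add: diff)
  show "measure (diff_measure M N) A = measure M A - measure N A" if "A \<in> sets M"
    using diff[OF that] le[OF that] by (simp add: measure_def)
qed

definition product_subcoupling :: "'a measure \<Rightarrow> 'b measure \<Rightarrow> ('a \<times> 'b) measure" where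
  "product_subcoupling M N = scale_measure (ennreal (1 / measure N (space N))) (M \<Otimes>\<^sub>M N)"

lemma sets_product_subcoupling [simp]: "sets (product_subcoupling M N) = sets (M \<Otimes>\<^sub>M N)"
  by (simp add: product_subcoupling_def)

lemma measure_product_subcoupling_Times:
  assumes "finite_measure N" "A \<in> sets M" "B \<in> sets N"
  shows "measure (product_subcoupling M N) (A \<times> B) = measure M A * measure N B / measure N (space N)"
proof -
  interpret N: finite_measure N by fact
  have "measure (M \<Otimes>\<^sub>M N) (A \<times> B) = measure M A * measure N B"
    using assms by (simp add: measure_def N.emeasure_pair_measure_Times enn2real_mult)
  then show ?thesis
    by (simp add: product_subcoupling_def)
qed

lemma finite_measure_product_subcoupling:
  assumes "finite_measure M" "finite_measure N"
  shows "finite_measure (product_subcoupling M N)"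
proof
  have "finite_measure (M \<Otimes>\<^sub>M N)"
    using assms(2,1) by (rule finite_measure_pair_measure)
  then show "emeasure (product_subcoupling M N) (space (product_subcoupling M N)) \<noteq> \<infinity>"
    using finite_measure.emeasure_finite
    by (auto simp: product_subcoupling_def space_scale_measure ennreal_mult_eq_top_iff)
qed

lemma measure_product_subcoupling_fst:
  assumes "finite_measure M" "finite_measure N" "measure M (space M) \<le> measure N (space N)" "A \<in> sets M"
  shows "measure (product_subcoupling M N) (A \<times> space N) = measure M A"
proof (cases "measure N (space N) = 0")
  case True
  then have "measure M A = 0"
    using finite_measure.bounded_measure[OF assms(1), of A] assms(3) by (simp add: measure_le_0_iff)
  then show ?thesis
    by (simp add: measure_product_subcoupling_Times assms)
qed (simp add: measure_product_subcoupling_Times assms)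

lemma measure_product_subcoupling_snd_le:
  assumes "finite_measure N" "measure M (space M) \<le> measure N (space N)" "B \<in> sets N"
  shows "measure (product_subcoupling M N) (space M \<times> B) \<le> measure N B"
proof -
  have "measure M (space M) / measure N (space N) \<le> 1"
    using assms(2) by (simp add: divide_le_eq_1 less_le)
  then have "measure M (space M) / measure N (space N) * measure N B \<le> 1 * measure N B"
    by (intro mult_right_mono) auto
  then show ?thesis
    by (simp add: measure_product_subcoupling_Times assms)
qed

lemma measurable_finite_borel_measure:
  assumes "finite_borel_measure M" "f \<in> borel_measurable borel"
  shows "f \<in> borel_measurable M"
  using assms measurable_cong_sets[OF finite_borel_measureD(2)[OF assms(1)] refl] by blast

lemma finite_borel_measure_distr:
  assumes "finite_borel_measure M" "f \<in> borel_measurable borel"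
  shows "finite_borel_measure (distr M borel f)"
  using finite_measure.finite_measure_distr[OF finite_borel_measureD(1)[OF assms(1)]
      measurable_finite_borel_measure[OF assms]]
  by (simp add: finite_borel_measure_def)

lemma borel_measurable_fst_snd:
  "(fst :: 'a::topological_space \<times> 'b::topological_space \<Rightarrow> 'a) \<in> borel_measurable borel"
  "(snd :: 'a \<times> 'b \<Rightarrow> 'b) \<in> borel_measurable borel"
  by (auto intro!: borel_measurable_continuous_onI continuous_intros)

lemma measure_distr_fst:
  fixes \<alpha> :: "('a::topological_space \<times> 'b::topological_space) measure"
  assumes "finite_borel_measure \<alpha>" "A \<in> sets borel"
  shows "measure (distr \<alpha> borel fst) A = measure \<alpha> (A \<times> UNIV)"
  using measurable_finite_borel_measure[OF assms(1) borel_measurable_fst_snd(1)] assms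
  by (simp add: measure_distr finite_borel_measureD fst_vimage_eq_Times)

lemma measure_distr_snd:
  fixes \<alpha> :: "('a::topological_space \<times> 'b::topological_space) measure"
  assumes "finite_borel_measure \<alpha>" "B \<in> sets borel"
  shows "measure (distr \<alpha> borel snd) B = measure \<alpha> (UNIV \<times> B)"
  using measurable_finite_borel_measure[OF assms(1) borel_measurable_fst_snd(2)] assms
  by (simp add: measure_distr finite_borel_measureD snd_vimage_eq_Times)

lemma finite_borel_measure_marginals:
  fixes \<alpha> :: "('a::topological_space \<times> 'b::topological_space) measure"
  assumes "finite_borel_measure \<alpha>"
  shows "finite_borel_measure (distr \<alpha> borel fst)" "finite_borel_measure (distr \<alpha> borel snd)"
  by (intro finite_borel_measure_distr[OF assms] borel_measurable_fst_snd)+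

lemma finite_borel_measure_eqI:
  assumes "finite_borel_measure M" "finite_borel_measure N"
    and "\<And>A. A \<in> sets borel \<Longrightarrow> measure M A = measure N A"
  shows "M = N"
  using assms(3) finite_borel_measureD[OF assms(1)] finite_borel_measureD[OF assms(2)]
  by (intro measure_eqI) (simp_all add: finite_measure.emeasure_eq_measure)

lemma finite_borel_measure_diff_measure:
  assumes M: "finite_borel_measure M" and N: "finite_borel_measure N"
    and le: "\<And>A. A \<in> sets borel \<Longrightarrow> measure N A \<le> measure M A"
  shows "finite_borel_measure (diff_measure M N)"
    and "A \<in> sets borel \<Longrightarrow> measure (diff_measure M N) A = measure M A - measure N A"
  using finite_measure_diff_measure[of M N] le finite_borel_measureD[OF M] finite_borel_measureD[OF N]
  by (simp_all add: finite_borel_measure_def)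

lemma residual_marginals:
  fixes \<gamma> :: "('a::topological_space \<times> 'b::topological_space) measure"
  assumes \<mu>: "finite_borel_measure \<mu>" and \<nu>: "finite_borel_measure \<nu>"
    and \<gamma>: "finite_borel_measure \<gamma>" "marginals_le_on (sets \<mu>) (sets \<nu>) (measure \<gamma>) \<mu> \<nu>"
  obtains P Q where "finite_borel_measure P" "finite_borel_measure Q"
    "\<And>A. A \<in> sets borel \<Longrightarrow> measure P A = measure \<mu> A - measure \<gamma> (A \<times> UNIV)"
    "\<And>B. B \<in> sets borel \<Longrightarrow> measure Q B = measure \<nu> B - measure \<gamma> (UNIV \<times> B)"
proof
  note marginals = finite_borel_measure_marginals[OF \<gamma>(1)]
  let ?P = "diff_measure \<mu> (distr \<gamma> borel fst)" and ?Q = "diff_measure \<nu> (distr \<gamma> borel snd)"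
  have le_\<mu>: "measure (distr \<gamma> borel fst) A \<le> measure \<mu> A" if "A \<in> sets borel" for A
    using \<gamma>(2) that \<mu> \<nu> by (simp add: measure_distr_fst \<gamma>(1) marginals_le_on_def finite_borel_measureD)
  show "finite_borel_measure ?P"
    by (rule finite_borel_measure_diff_measure(1)[OF \<mu> marginals(1) le_\<mu>])
  show "measure ?P A = measure \<mu> A - measure \<gamma> (A \<times> UNIV)" if "A \<in> sets borel" for A
    using finite_borel_measure_diff_measure(2)[OF \<mu> marginals(1) le_\<mu> that] that
    by (simp add: measure_distr_fst \<gamma>(1))
  have le_\<nu>: "measure (distr \<gamma> borel snd) B \<le> measure \<nu> B" if "B \<in> sets borel" for B
    using \<gamma>(2) that \<mu> \<nu> by (simp add: measure_distr_snd \<gamma>(1) marginals_le_on_def finite_borel_measureD)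
  show "finite_borel_measure ?Q"
    by (rule finite_borel_measure_diff_measure(1)[OF \<nu> marginals(2) le_\<nu>])
  show "measure ?Q B = measure \<nu> B - measure \<gamma> (UNIV \<times> B)" if "B \<in> sets borel" for B
    using finite_borel_measure_diff_measure(2)[OF \<nu> marginals(2) le_\<nu> that] that
    by (simp add: measure_distr_snd \<gamma>(1))
qed

lemma partial_coupling_completion:
  fixes \<mu> :: "'a::second_countable_topology measure" and \<nu> :: "'b::second_countable_topology measure"
  assumes \<mu>: "finite_borel_measure \<mu>" and \<nu>: "finite_borel_measure \<nu>"
    and mass: "measure \<mu> UNIV \<le> measure \<nu> UNIV"
    and \<gamma>: "finite_borel_measure \<gamma>" "marginals_le_on (sets \<mu>) (sets \<nu>) (measure \<gamma>) \<mu> \<nu>"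
  obtains \<alpha> where "finite_borel_measure \<alpha>" "distr \<alpha> borel fst = \<mu>"
    "\<And>B. B \<in> sets borel \<Longrightarrow> measure (distr \<alpha> borel snd) B \<le> measure \<nu> B"
    "\<And>T. T \<in> sets borel \<Longrightarrow> measure \<alpha> T \<le> measure \<gamma> T + (measure \<mu> UNIV - measure \<gamma> UNIV)"
proof -
  note \<gamma>' = finite_borel_measureD[OF \<gamma>(1)]
  obtain P Q where P: "finite_borel_measure P" and Q: "finite_borel_measure Q"
    and P_eq: "\<And>A. A \<in> sets borel \<Longrightarrow> measure P A = measure \<mu> A - measure \<gamma> (A \<times> UNIV)"
    and Q_eq: "\<And>B. B \<in> sets borel \<Longrightarrow> measure Q B = measure \<nu> B - measure \<gamma> (UNIV \<times> B)"
    by (rule residual_marginals[OF \<mu> \<nu> \<gamma>]) (rule that)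
  note P' = finite_borel_measureD[OF P] and Q' = finite_borel_measureD[OF Q]
  have PQ: "measure P (space P) \<le> measure Q (space Q)"
    using mass by (simp add: P' Q' P_eq Q_eq)
  define \<eta> where "\<eta> = product_subcoupling P Q"
  have \<eta>: "finite_measure \<eta>" "sets \<eta> = sets \<gamma>"
    using finite_measure_product_subcoupling[OF P'(1) Q'(1)] sets_pair_measure_cong[OF P'(2) Q'(2)]
    by (simp_all add: \<eta>_def \<gamma>' flip: borel_prod)
  have \<eta>_fst: "measure \<eta> (A \<times> UNIV) = measure P A" if "A \<in> sets borel" for A
    using measure_product_subcoupling_fst[OF P'(1) Q'(1) PQ, of A] that by (simp add: \<eta>_def P' Q')
  have \<eta>_snd: "measure \<eta> (UNIV \<times> B) \<le> measure Q B" if "B \<in> sets borel" for B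
    using measure_product_subcoupling_snd_le[OF Q'(1) PQ, of B] that by (simp add: \<eta>_def P' Q')
  define \<alpha> where "\<alpha> = add_measure \<gamma> \<eta>"
  have \<alpha>: "finite_borel_measure \<alpha>"
    using finite_measure_add_measure[OF \<gamma>'(1) \<eta>] by (simp add: \<alpha>_def finite_borel_measure_def \<gamma>')
  have \<alpha>_eq: "measure \<alpha> T = measure \<gamma> T + measure \<eta> T" if "T \<in> sets borel" for T
    using measure_add_measure[OF \<gamma>'(1) \<eta>] that by (simp add: \<alpha>_def \<gamma>')
  show thesis
  proof (rule that[OF \<alpha>])
    show "distr \<alpha> borel fst = \<mu>"
      by (rule finite_borel_measure_eqI[OF finite_borel_measure_marginals(1)[OF \<alpha>] \<mu>])
         (simp add: measure_distr_fst \<alpha> \<alpha>_eq \<eta>_fst P_eq borel_Times)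
    show "measure (distr \<alpha> borel snd) B \<le> measure \<nu> B" if "B \<in> sets borel" for B
      using \<eta>_snd[OF that] that by (simp add: measure_distr_snd \<alpha> \<alpha>_eq Q_eq borel_Times)
    show "measure \<alpha> T \<le> measure \<gamma> T + (measure \<mu> UNIV - measure \<gamma> UNIV)" if "T \<in> sets borel" for T
    proof -
      have "measure \<eta> T \<le> measure \<eta> (UNIV \<times> UNIV)"
        using finite_measure.bounded_measure[OF \<eta>(1), of T] sets_eq_imp_space_eq[OF \<eta>(2)] by (simp add: \<gamma>')
      also have "\<dots> = measure \<mu> UNIV - measure \<gamma> UNIV"
        by (subst \<eta>_fst) (simp_all add: P_eq)
      finally show ?thesis
        by (simp add: \<alpha>_eq[OF that])
    qed
  qed
qed

section \<open>Supports, total variation and thickenings\<close>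

lemma abs_measure_diff_le_tv_dist:
  assumes "finite_measure M" "finite_measure N" "A \<in> sets borel"
  shows "\<bar>measure M A - measure N A\<bar> \<le> tv_dist M N"
  unfolding tv_dist_def
proof (rule cSUP_upper[OF assms(3)])
  interpret M: finite_measure M by fact
  interpret N: finite_measure N by fact
  show "bdd_above ((\<lambda>A. \<bar>measure M A - measure N A\<bar>) ` sets borel)"
  proof (rule bdd_aboveI2)
    fix A :: "'a set"
    show "\<bar>measure M A - measure N A\<bar> \<le> measure M (space M) + measure N (space N)"
      using M.bounded_measure[of A] N.bounded_measure[of A] measure_nonneg[of M A] measure_nonneg[of N A]
      by linarith
  qed
qed

lemma tv_dist_self [simp]: "tv_dist M M = 0"
  using sets.empty_sets[of borel] by (auto simp: tv_dist_def intro: cSUP_const)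

lemma tv_dist_le_mass_diff:
  assumes M: "finite_borel_measure M" and N: "finite_borel_measure N"
    and le: "\<And>A. A \<in> sets borel \<Longrightarrow> measure M A \<le> measure N A"
  shows "tv_dist M N \<le> measure N UNIV - measure M UNIV"
  unfolding tv_dist_def
proof (rule cSUP_least)
  show "sets (borel :: 'a measure) \<noteq> {}"
    by blast
  note M' = finite_borel_measureD[OF M] and N' = finite_borel_measureD[OF N]
  interpret M: finite_measure M by fact
  interpret N: finite_measure N by fact
  fix A :: "'a set" assume A: "A \<in> sets borel"
  have "measure M (UNIV - A) = measure M UNIV - measure M A"
    "measure N (UNIV - A) = measure N UNIV - measure N A"
    using A M.finite_measure_compl[of A] N.finite_measure_compl[of A] by (simp_all add: M' N')
  moreover have "measure M (UNIV - A) \<le> measure N (UNIV - A)"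
    using A by (intro le) auto
  ultimately show "\<bar>measure M A - measure N A\<bar> \<le> measure N UNIV - measure M UNIV"
    using le[OF A] by simp
qed

lemma Compl_msupp_null:
  fixes M :: "'a::{metric_space,second_countable_topology} measure"
  assumes M: "finite_borel_measure M"
  shows "- msupp M \<in> null_sets M"
proof -
  note M' = finite_borel_measureD[OF M]
  define \<U> where "\<U> = {U. open U \<and> U \<in> null_sets M}"
  have "z \<in> - msupp M \<longleftrightarrow> z \<in> \<Union>\<U>" for z
  proof
    assume "z \<in> - msupp M"
    then obtain r where "0 < r" "emeasure M (ball z r) = 0"
      unfolding msupp_def by auto
    then show "z \<in> \<Union>\<U>"
      by (intro UnionI[of "ball z r"]) (auto simp: \<U>_def null_sets_def M')
  next
    assume "z \<in> \<Union>\<U>"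
    then obtain U where U: "open U" "U \<in> null_sets M" "z \<in> U"
      by (auto simp: \<U>_def)
    obtain r where r: "0 < r" "ball z r \<subseteq> U"
      by (rule openE[OF U(1,3)])
    have "emeasure M (ball z r) \<le> emeasure M U"
      using r(2) U(2) by (intro emeasure_mono) auto
    then have "emeasure M (ball z r) = 0"
      using U(2) by (simp add: null_setsD1)
    then show "z \<in> - msupp M"
      using r(1) unfolding msupp_def by auto
  qed
  then have "- msupp M = \<Union>\<U>"
    by (rule set_eqI)
  moreover have "\<Union>\<U> \<in> null_sets M"
    by (rule Union_open_null) (simp_all add: \<U>_def)
  ultimately show ?thesis
    by simp
qed

lemma marginals_le_imp_null_outside_supports:
  fixes \<mu> :: "'a::{metric_space,second_countable_topology} measure"
    and \<nu> :: "'b::{metric_space,second_countable_topology} measure"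
  assumes \<mu>: "finite_borel_measure \<mu>" and \<nu>: "finite_borel_measure \<nu>" and \<alpha>: "finite_borel_measure \<alpha>"
    and fst: "\<And>A. A \<in> sets borel \<Longrightarrow> measure (distr \<alpha> borel fst) A \<le> measure \<mu> A"
    and snd: "\<And>B. B \<in> sets borel \<Longrightarrow> measure (distr \<alpha> borel snd) B \<le> measure \<nu> B"
  shows "emeasure \<alpha> (UNIV - msupp \<mu> \<times> msupp \<nu>) = 0"
proof -
  note \<mu>' = finite_borel_measureD[OF \<mu>] and \<nu>' = finite_borel_measureD[OF \<nu>] and \<alpha>' = finite_borel_measureD[OF \<alpha>]
  have null: "- msupp \<mu> \<in> null_sets \<mu>" "- msupp \<nu> \<in> null_sets \<nu>"
    by (rule Compl_msupp_null[OF \<mu>], rule Compl_msupp_null[OF \<nu>])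
  then have sets: "- msupp \<mu> \<in> sets borel" "- msupp \<nu> \<in> sets borel"
    using \<mu>'(2) \<nu>'(2) by auto
  have "measure \<alpha> ((- msupp \<mu>) \<times> UNIV) = 0"
    using fst[OF sets(1)] measure_eq_0_null_sets[OF null(1)]
    by (simp add: measure_distr_fst[OF \<alpha> sets(1)] measure_le_0_iff)
  moreover have "measure \<alpha> (UNIV \<times> (- msupp \<nu>)) = 0"
    using snd[OF sets(2)] measure_eq_0_null_sets[OF null(2)]
    by (simp add: measure_distr_snd[OF \<alpha> sets(2)] measure_le_0_iff)
  ultimately have "(- msupp \<mu>) \<times> UNIV \<in> null_sets \<alpha>" "UNIV \<times> (- msupp \<nu>) \<in> null_sets \<alpha>"
    using sets by (simp_all add: null_sets_def \<alpha>' borel_Times finite_measure.emeasure_eq_measure)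
  then have "(- msupp \<mu>) \<times> UNIV \<union> UNIV \<times> (- msupp \<nu>) \<in> null_sets \<alpha>"
    by (rule null_sets.Un)
  moreover have "UNIV - msupp \<mu> \<times> msupp \<nu> = (- msupp \<mu>) \<times> UNIV \<union> UNIV \<times> (- msupp \<nu>)"
    by auto
  ultimately show ?thesis
    by (simp add: null_setsD1)
qed

lemma cthick_compact:
  fixes K :: "'a::metric_space set"
  assumes "compact K" "K \<noteq> {}"
  shows "cthick K e = {z. infdist z K \<le> e}"
proof (intro set_eqI iffI)
  fix z assume "z \<in> cthick K e"
  then show "z \<in> {z. infdist z K \<le> e}"
    by (auto simp: cthick_def intro: infdist_le2)
next
  fix z assume z: "z \<in> {z. infdist z K \<le> e}"
  obtain a where "a \<in> K" "setdist {z} K = infdist a {z}"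
    by (rule setdist_attains_inf[OF assms])
  then show "z \<in> cthick K e"
    using z by (auto simp: cthick_def infdist_eq_setdist dist_commute)
qed

lemma closed_cthick_compact:
  fixes K :: "'a::metric_space set"
  assumes "compact K"
  shows "closed (cthick K e)"
proof (cases "K = {}")
  case False
  then show ?thesis
    unfolding cthick_compact[OF assms False]
    by (intro closed_Collect_le continuous_intros)
qed (simp add: cthick_def)

lemma INT_cthick_compact:
  fixes K :: "'a::metric_space set"
  assumes "compact K"
  shows "(\<Inter>n. cthick K (e + 1 / Suc n)) = cthick K e"
proof (cases "K = {}")
  case False
  have "(\<forall>n. x \<le> e + 1 / Suc n) \<longleftrightarrow> x \<le> e" for x
  proof
    assume "\<forall>n. x \<le> e + 1 / Suc n"
    then show "x \<le> e"
      using LIMSEQ_le_const[OF LIMSEQ_inverse_real_of_nat_add[of e], of x] by (simp add: inverse_eq_divide)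
  qed (auto intro: add_increasing2)
  then show ?thesis
    unfolding cthick_compact[OF assms False] by auto
qed (simp add: cthick_def)

lemma cthick_mono:
  assumes "A \<subseteq> B" and "d \<le> e"
  shows "cthick A d \<subseteq> cthick B e"
  unfolding cthick_def using assms by (blast intro: order_trans)

section \<open>The Prokhorov distance\<close>

definition prokhorov_admissible :: "'a::metric_space measure \<Rightarrow> 'a measure \<Rightarrow> real set" where
  "prokhorov_admissible \<mu> \<nu> = {e. e > 0 \<and> (\<forall>A. closed A \<longrightarrow>
       measure \<mu> A \<le> measure (completion \<nu>) (cthick A e) + e \<and>
       measure \<nu> A \<le> measure (completion \<mu>) (cthick A e) + e)}"

lemma prokhorov_dist_eq_Inf: "prokhorov_dist \<mu> \<nu> = Inf (prokhorov_admissible \<mu> \<nu>)"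
  by (simp add: prokhorov_dist_def prokhorov_admissible_def)

lemma bdd_below_prokhorov_admissible: "bdd_below (prokhorov_admissible \<mu> \<nu>)"
  by (rule bdd_belowI[of _ 0]) (simp add: prokhorov_admissible_def)

lemma prokhorov_admissible_nonempty:
  assumes "finite_borel_measure \<mu>" "finite_borel_measure \<nu>"
  shows "prokhorov_admissible \<mu> \<nu> \<noteq> {}"
proof -
  interpret \<mu>: finite_measure \<mu>
    using assms by (simp add: finite_borel_measure_def)
  interpret \<nu>: finite_measure \<nu>
    using assms by (simp add: finite_borel_measure_def)
  let ?e = "measure \<mu> (space \<mu>) + measure \<nu> (space \<nu>) + 1"
  have "measure \<mu> A \<le> measure (completion \<nu>) B + ?e" "measure \<nu> A \<le> measure (completion \<mu>) B + ?e" for A B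
    using \<mu>.bounded_measure[of A] \<nu>.bounded_measure[of A] measure_nonneg[of "completion \<nu>" B]
      measure_nonneg[of "completion \<mu>" B] measure_nonneg[of \<mu> "space \<mu>"] measure_nonneg[of \<nu> "space \<nu>"]
    by linarith+
  moreover have "0 < ?e"
    by (simp add: add_nonneg_pos)
  ultimately have "?e \<in> prokhorov_admissible \<mu> \<nu>"
    by (simp add: prokhorov_admissible_def)
  then show ?thesis
    by blast
qed

lemma prokhorov_dist_nonneg:
  assumes "finite_borel_measure \<mu>" "finite_borel_measure \<nu>"
  shows "0 \<le> prokhorov_dist \<mu> \<nu>"
  unfolding prokhorov_dist_eq_Inf
  by (rule cInf_greatest[OF prokhorov_admissible_nonempty[OF assms]])
     (simp add: prokhorov_admissible_def)

lemma prokhorov_dist_commute: "prokhorov_dist \<mu> \<nu> = prokhorov_dist \<nu> \<mu>"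
  unfolding prokhorov_dist_def by (simp only: conj_commute)

lemma measure_compact_le_of_prokhorov_dist_less:
  fixes \<mu> \<nu> :: "'a::metric_space measure"
  assumes \<mu>: "finite_borel_measure \<mu>" and \<nu>: "finite_borel_measure \<nu>"
    and K: "compact K" and e: "prokhorov_dist \<mu> \<nu> < e"
  shows "measure \<nu> K \<le> measure \<mu> (cthick K e) + e"
proof -
  interpret \<mu>: finite_measure \<mu>
    by (rule finite_borel_measureD[OF \<mu>])
  have thick: "cthick K r \<in> sets \<mu>" for r
    using closed_cthick_compact[OF K] by (simp add: finite_borel_measureD[OF \<mu>])
  obtain r where r: "r \<in> prokhorov_admissible \<mu> \<nu>" "r < e"
    using cInf_lessD[OF prokhorov_admissible_nonempty[OF \<mu> \<nu>]] e
    unfolding prokhorov_dist_eq_Inf by blast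
  then have "measure \<nu> K \<le> measure \<mu> (cthick K r) + r"
    using compact_imp_closed[OF K] thick by (auto simp: prokhorov_admissible_def)
  also have "\<dots> \<le> measure \<mu> (cthick K e) + e"
    using r(2) thick by (intro add_mono \<mu>.finite_measure_mono cthick_mono) auto
  finally show ?thesis .
qed

lemma measure_compact_le_prokhorov_dist:
  fixes \<mu> \<nu> :: "'a::metric_space measure"
  assumes \<mu>: "finite_borel_measure \<mu>" and \<nu>: "finite_borel_measure \<nu>" and K: "compact K"
  defines "d \<equiv> prokhorov_dist \<mu> \<nu>"
  shows "measure \<nu> K \<le> measure \<mu> (cthick K d) + d"
proof -
  interpret \<mu>: finite_measure \<mu>
    by (rule finite_borel_measureD[OF \<mu>])
  let ?d = "\<lambda>n. d + 1 / real (Suc n)"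
  have "(\<lambda>n. measure \<mu> (cthick K (?d n))) \<longlonglongrightarrow> measure \<mu> (\<Inter>n. cthick K (?d n))"
  proof (rule \<mu>.finite_Lim_measure_decseq)
    show "range (\<lambda>n. cthick K (?d n)) \<subseteq> sets \<mu>"
      using closed_cthick_compact[OF K] by (auto simp: finite_borel_measureD[OF \<mu>])
    show "decseq (\<lambda>n. cthick K (?d n))"
      by (intro antimonoI cthick_mono add_mono divide_left_mono) auto
  qed
  moreover have "?d \<longlonglongrightarrow> d"
    using LIMSEQ_inverse_real_of_nat_add[of d] by (simp add: inverse_eq_divide)
  ultimately have "(\<lambda>n. measure \<mu> (cthick K (?d n)) + ?d n) \<longlonglongrightarrow> measure \<mu> (cthick K d) + d"
    unfolding INT_cthick_compact[OF K] by (rule tendsto_add)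
  moreover have "measure \<nu> K \<le> measure \<mu> (cthick K (?d n)) + ?d n" for n
    by (rule measure_compact_le_of_prokhorov_dist_less[OF \<mu> \<nu> K]) (simp add: d_def)
  ultimately show ?thesis
    using LIMSEQ_le_const by fastforce
qed

lemma sets_dist_gt: "{(x :: 'a::{metric_space,second_countable_topology}, y). dist x y > e} \<in> sets borel"
proof -
  have "open {p :: 'a \<times> 'a. e < dist (fst p) (snd p)}"
    by (intro open_Collect_less continuous_intros)
  then show ?thesis
    by (simp add: case_prod_unfold)
qed

lemma strassen_condition_prokhorov_dist:
  fixes \<mu> \<nu> :: "'a::polish_space measure"
  assumes \<mu>: "finite_borel_measure \<mu>" and \<nu>: "finite_borel_measure \<nu>"
  defines "d \<equiv> prokhorov_dist \<mu> \<nu>"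
  shows "strassen_condition {p. dist (fst p) (snd p) \<le> d} d \<mu> \<nu>"
proof (rule strassen_condition_compactI[OF \<mu> \<nu>])
  interpret \<mu>: finite_measure \<mu>
    by (rule finite_borel_measureD[OF \<mu>])
  fix K U :: "'a set"
  assume K: "compact K" and U: "U \<in> sets borel" "{p. dist (fst p) (snd p) \<le> d}\<inverse> `` K \<subseteq> U"
  have "cthick K d \<subseteq> U"
    using U(2) by (auto simp: cthick_def Image_def)
  then have "measure \<mu> (cthick K d) \<le> measure \<mu> U"
    using U(1) by (intro \<mu>.finite_measure_mono) (simp_all add: finite_borel_measureD[OF \<mu>])
  then show "measure \<nu> K \<le> measure \<mu> U + d"
    using measure_compact_le_prokhorov_dist[OF \<mu> \<nu> K] by (simp add: d_def)
qed

lemma ex_dominated_coupling_ok_prokhorov_dist: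
  fixes \<mu> \<nu> :: "'a::polish_space measure"
  assumes \<mu>: "finite_borel_measure \<mu>" and \<nu>: "finite_borel_measure \<nu>"
    and mass: "measure \<mu> UNIV \<le> measure \<nu> UNIV"
  obtains \<alpha> where "finite_borel_measure \<alpha>" "coupling_ok \<alpha> \<mu> \<nu> (prokhorov_dist \<mu> \<nu>)"
    "distr \<alpha> borel fst = \<mu>" "\<And>B. B \<in> sets borel \<Longrightarrow> measure (distr \<alpha> borel snd) B \<le> measure \<nu> B"
proof -
  define d where "d = prokhorov_dist \<mu> \<nu>"
  let ?S = "{p :: 'a \<times> 'a. dist (fst p) (snd p) \<le> d}"
  have "closed ?S"
    by (intro closed_Collect_le continuous_intros)
  then obtain \<gamma> where \<gamma>: "finite_borel_measure \<gamma>" "marginals_le_on (sets \<mu>) (sets \<nu>) (measure \<gamma>) \<mu> \<nu>"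
    "measure \<gamma> (- ?S) = 0" "measure \<nu> UNIV - d \<le> measure \<gamma> UNIV"
    by (rule strassen_partial_coupling[OF \<mu> \<nu> _ strassen_condition_prokhorov_dist[OF \<mu> \<nu>, folded d_def]])
  obtain \<alpha> where \<alpha>: "finite_borel_measure \<alpha>" "distr \<alpha> borel fst = \<mu>"
    "\<And>B. B \<in> sets borel \<Longrightarrow> measure (distr \<alpha> borel snd) B \<le> measure \<nu> B"
    "\<And>T. T \<in> sets borel \<Longrightarrow> measure \<alpha> T \<le> measure \<gamma> T + (measure \<mu> UNIV - measure \<gamma> UNIV)"
    by (rule partial_coupling_completion[OF \<mu> \<nu> mass \<gamma>(1,2)]) (rule that)
  have "{(x, y). dist x y > d} = - ?S"
    by auto
  then have "measure \<alpha> {(x, y). dist x y > d} \<le> measure \<mu> UNIV - measure \<gamma> UNIV"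
    using \<alpha>(4)[OF sets_dist_gt[of d]] \<gamma>(3) by simp
  moreover have "measure (distr \<alpha> borel snd) UNIV = measure \<mu> UNIV"
    using measure_distr_fst[OF \<alpha>(1), of UNIV] by (simp add: measure_distr_snd[OF \<alpha>(1)] \<alpha>(2))
  then have "tv_dist (distr \<alpha> borel snd) \<nu> \<le> measure \<nu> UNIV - measure \<mu> UNIV"
    using tv_dist_le_mass_diff[OF finite_borel_measure_marginals(2)[OF \<alpha>(1)] \<nu> \<alpha>(3)] by simp
  ultimately have "coupling_ok \<alpha> \<mu> \<nu> d"
    using \<gamma>(4) by (simp add: coupling_ok_def discrepancy_def \<alpha>(2))
  then show thesis
    using \<alpha> by (intro that) (simp_all add: d_def)
qed

lemma coupling_ok_mono:
  fixes \<alpha> :: "('a::{metric_space,second_countable_topology} \<times> 'a) measure"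
  assumes \<alpha>: "finite_borel_measure \<alpha>" "coupling_ok \<alpha> \<mu> \<nu> d" "d \<le> e"
  shows "coupling_ok \<alpha> \<mu> \<nu> e"
proof -
  interpret finite_measure \<alpha>
    using \<alpha> by (simp add: finite_borel_measure_def)
  have "measure \<alpha> {(x, y). dist x y > e} \<le> measure \<alpha> {(x, y). dist x y > d}"
    using \<alpha>(3) sets_dist_gt finite_borel_measureD(2)[OF \<alpha>(1)] by (intro finite_measure_mono) auto
  then show ?thesis
    using \<alpha>(2,3) by (simp add: coupling_ok_def)
qed

lemma coupling_ok_swap:
  fixes \<alpha> :: "('a::{metric_space,second_countable_topology} \<times> 'a) measure"
  assumes \<alpha>: "finite_borel_measure \<alpha>" "coupling_ok \<alpha> \<mu> \<nu> e"
  defines "\<alpha>' \<equiv> distr \<alpha> borel prod.swap"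
  shows "finite_borel_measure \<alpha>'" "coupling_ok \<alpha>' \<nu> \<mu> e"
proof -
  have swap: "(prod.swap :: 'a \<times> 'a \<Rightarrow> 'a \<times> 'a) \<in> borel_measurable borel"
    by (intro borel_measurable_continuous_onI) (auto simp: prod.swap_def intro!: continuous_intros)
  note swap_\<alpha> = measurable_finite_borel_measure[OF \<alpha>(1) swap]
  show "finite_borel_measure \<alpha>'"
    unfolding \<alpha>'_def by (rule finite_borel_measure_distr[OF \<alpha>(1) swap])
  have "distr \<alpha>' borel fst = distr \<alpha> borel snd" "distr \<alpha>' borel snd = distr \<alpha> borel fst"
    unfolding \<alpha>'_def using swap_\<alpha> by (simp_all add: distr_distr borel_measurable_fst_snd comp_def)
  moreover have "prod.swap -` {(x, y). dist x y > e} = {(x :: 'a, y). dist x y > e}"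
    by (auto simp: dist_commute)
  then have "measure \<alpha>' {(x, y). dist x y > e} = measure \<alpha> {(x, y). dist x y > e}"
    unfolding \<alpha>'_def by (simp add: measure_distr[OF swap_\<alpha> sets_dist_gt] finite_borel_measureD(3)[OF \<alpha>(1)])
  ultimately show "coupling_ok \<alpha>' \<nu> \<mu> e"
    using \<alpha>(2) by (simp add: coupling_ok_def discrepancy_def)
qed

lemma measure_Times_UNIV_le_if_cthick_subset:
  fixes \<alpha> :: "('a::{metric_space,second_countable_topology} \<times> 'a) measure"
  assumes \<alpha>: "finite_borel_measure \<alpha>"
    and AB: "A \<in> sets borel" "B \<in> sets borel" "cthick A e \<subseteq> B"
  shows "measure \<alpha> (A \<times> UNIV) \<le> measure \<alpha> (UNIV \<times> B) + measure \<alpha> {(x, y). dist x y > e}"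
proof -
  note \<alpha>' = finite_borel_measureD[OF \<alpha>]
  interpret finite_measure \<alpha> by fact
  let ?D = "{(x, y). dist x y > e} :: ('a \<times> 'a) set"
  have "e < dist x y" if "x \<in> A" "y \<notin> B" for x y
  proof (rule ccontr)
    assume "\<not> e < dist x y"
    then have "y \<in> cthick A e"
      using that(1) by (auto simp: cthick_def dist_commute intro!: bexI[of _ x])
    then show False
      using AB(3) that(2) by auto
  qed
  then have "A \<times> UNIV \<subseteq> UNIV \<times> B \<union> ?D"
    by auto
  then have "measure \<alpha> (A \<times> UNIV) \<le> measure \<alpha> (UNIV \<times> B \<union> ?D)"
    using AB(2) sets_dist_gt by (intro finite_measure_mono sets.Un) (simp_all add: \<alpha>' borel_Times)
  also have "\<dots> \<le> measure \<alpha> (UNIV \<times> B) + measure \<alpha> ?D"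
    using AB(2) sets_dist_gt by (intro measure_Un_le) (simp_all add: \<alpha>' borel_Times)
  finally show ?thesis .
qed

lemma coupling_imp_measure_closed_le:
  fixes \<mu> \<nu> :: "'a::polish_space measure"
  assumes \<mu>: "finite_borel_measure \<mu>" and \<nu>: "finite_borel_measure \<nu>"
    and \<alpha>: "finite_borel_measure \<alpha>" "coupling_ok \<alpha> \<mu> \<nu> e" and A: "closed A"
  shows "measure \<mu> A \<le> measure (completion \<nu>) (cthick A e) + e"
proof -
  note marginals = finite_borel_measure_marginals[OF \<alpha>(1), THEN finite_borel_measureD(1)]
  obtain B where "B \<in> sets \<nu>" and B: "cthick A e \<subseteq> B" "emeasure (completion \<nu>) (cthick A e) = emeasure \<nu> B"
    using completion_upper[OF cthick_in_sets_completion[OF \<nu> A]] by blast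
  then have borel: "A \<in> sets borel" "B \<in> sets borel"
    using A finite_borel_measureD(2)[OF \<nu>] by simp_all
  have "measure \<mu> A \<le> measure \<alpha> (A \<times> UNIV) + tv_dist (distr \<alpha> borel fst) \<mu>"
    using abs_measure_diff_le_tv_dist[OF marginals(1) finite_borel_measureD(1)[OF \<mu>] borel(1)]
    by (simp add: measure_distr_fst[OF \<alpha>(1) borel(1)])
  moreover have "measure \<alpha> (A \<times> UNIV) \<le> measure \<alpha> (UNIV \<times> B) + measure \<alpha> {(x, y). dist x y > e}"
    by (rule measure_Times_UNIV_le_if_cthick_subset[OF \<alpha>(1) borel B(1)])
  moreover have "measure \<alpha> (UNIV \<times> B) \<le> measure \<nu> B + tv_dist (distr \<alpha> borel snd) \<nu>"
    using abs_measure_diff_le_tv_dist[OF marginals(2) finite_borel_measureD(1)[OF \<nu>] borel(2)]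
    by (simp add: measure_distr_snd[OF \<alpha>(1) borel(2)])
  moreover have "measure (completion \<nu>) (cthick A e) = measure \<nu> B"
    using B(2) by (simp add: measure_def)
  ultimately show ?thesis
    using \<alpha>(2) by (simp add: coupling_ok_def discrepancy_def)
qed

lemma coupling_imp_prokhorov_dist_le:
  fixes \<mu> \<nu> :: "'a::polish_space measure"
  assumes \<mu>: "finite_borel_measure \<mu>" and \<nu>: "finite_borel_measure \<nu>" and "0 \<le> e"
    and \<alpha>: "finite_borel_measure \<alpha>" "coupling_ok \<alpha> \<mu> \<nu> e"
  shows "prokhorov_dist \<mu> \<nu> \<le> e"
proof (rule dense_ge)
  fix e' assume e': "e < e'"
  then have ok: "coupling_ok \<alpha> \<mu> \<nu> e'"
    using coupling_ok_mono[OF \<alpha>] by simp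
  have "e' \<in> prokhorov_admissible \<mu> \<nu>"
    unfolding prokhorov_admissible_def
    using e' \<open>0 \<le> e\<close> coupling_imp_measure_closed_le[OF \<mu> \<nu> \<alpha>(1) ok]
      coupling_imp_measure_closed_le[OF \<nu> \<mu> coupling_ok_swap[OF \<alpha>(1) ok]] by simp
  then show "prokhorov_dist \<mu> \<nu> \<le> e'"
    unfolding prokhorov_dist_eq_Inf by (rule cInf_lower[OF _ bdd_below_prokhorov_admissible])
qed

lemma ex_coupling_ok_prokhorov_dist:
  fixes \<mu> \<nu> :: "'a::polish_space measure"
  assumes \<mu>: "finite_borel_measure \<mu>" and \<nu>: "finite_borel_measure \<nu>"
  obtains \<alpha> where "finite_borel_measure \<alpha>" "coupling_ok \<alpha> \<mu> \<nu> (prokhorov_dist \<mu> \<nu>)"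
proof (cases "measure \<mu> UNIV \<le> measure \<nu> UNIV")
  case True
  then show thesis
    using ex_dominated_coupling_ok_prokhorov_dist[OF \<mu> \<nu>] that by blast
next
  case False
  then have "measure \<nu> UNIV \<le> measure \<mu> UNIV"
    by simp
  then obtain \<alpha> where \<alpha>: "finite_borel_measure \<alpha>" "coupling_ok \<alpha> \<nu> \<mu> (prokhorov_dist \<nu> \<mu>)"
    using ex_dominated_coupling_ok_prokhorov_dist[OF \<nu> \<mu>] by blast
  from coupling_ok_swap[OF this] show thesis
    using that prokhorov_dist_commute[of \<mu> \<nu>] by simp
qed

theorem prokhorov_dist_le_iff:
  fixes \<mu> \<nu> :: "'a::polish_space measure"
  assumes \<mu>: "finite_borel_measure \<mu>" and \<nu>: "finite_borel_measure \<nu>" and "0 \<le> e"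
  shows "prokhorov_dist \<mu> \<nu> \<le> e \<longleftrightarrow> (\<exists>\<alpha>. finite_borel_measure \<alpha> \<and> coupling_ok \<alpha> \<mu> \<nu> e)"
proof
  assume le: "prokhorov_dist \<mu> \<nu> \<le> e"
  obtain \<alpha> where "finite_borel_measure \<alpha>" "coupling_ok \<alpha> \<mu> \<nu> (prokhorov_dist \<mu> \<nu>)"
    by (rule ex_coupling_ok_prokhorov_dist[OF \<mu> \<nu>])
  then show "\<exists>\<alpha>. finite_borel_measure \<alpha> \<and> coupling_ok \<alpha> \<mu> \<nu> e"
    using coupling_ok_mono[OF _ _ le] by blast
next
  assume "\<exists>\<alpha>. finite_borel_measure \<alpha> \<and> coupling_ok \<alpha> \<mu> \<nu> e"
  then show "prokhorov_dist \<mu> \<nu> \<le> e"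
    using coupling_imp_prokhorov_dist_le[OF assms] by blast
qed

theorem theorem2p1:
  fixes \<mu> \<nu> :: "'a::polish_space measure"
  assumes "finite_borel_measure \<mu>" and "finite_borel_measure \<nu>"
  shows "(\<forall>e\<ge>0. prokhorov_dist \<mu> \<nu> \<le> e \<longleftrightarrow>
            (\<exists>\<alpha>::('a \<times> 'a) measure. finite_borel_measure \<alpha> \<and> coupling_ok \<alpha> \<mu> \<nu> e))
       \<and> (prokhorov_dist \<mu> \<nu> \<in> {e. e \<ge> 0 \<and>
              (\<exists>\<alpha>::('a \<times> 'a) measure. finite_borel_measure \<alpha> \<and> coupling_ok \<alpha> \<mu> \<nu> e)}
          \<and> (\<forall>e\<in>{e. e \<ge> 0 \<and>
              (\<exists>\<alpha>::('a \<times> 'a) measure. finite_borel_measure \<alpha> \<and> coupling_ok \<alpha> \<mu> \<nu> e)}.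
                prokhorov_dist \<mu> \<nu> \<le> e))
       \<and> (measure \<mu> (space \<mu>) \<le> measure \<nu> (space \<nu>) \<longrightarrow>
            (\<exists>\<alpha>::('a \<times> 'a) measure. finite_borel_measure \<alpha>
               \<and> coupling_ok \<alpha> \<mu> \<nu> (prokhorov_dist \<mu> \<nu>)
               \<and> distr \<alpha> borel fst = \<mu>
               \<and> (\<forall>A\<in>sets borel. measure (distr \<alpha> borel snd) A \<le> measure \<nu> A)
               \<and> emeasure \<alpha> (UNIV - msupp \<mu> \<times> msupp \<nu>) = 0))"
proof (intro conjI allI ballI impI)
  let ?d = "prokhorov_dist \<mu> \<nu>" and ?ok = "\<lambda>\<alpha>. coupling_ok \<alpha> \<mu> \<nu>"
  show iff: "?d \<le> e \<longleftrightarrow> (\<exists>\<alpha>. finite_borel_measure \<alpha> \<and> ?ok \<alpha> e)" if "0 \<le> e" for e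
    using assms that by (rule prokhorov_dist_le_iff)
  show "?d \<in> {e. 0 \<le> e \<and> (\<exists>\<alpha>. finite_borel_measure \<alpha> \<and> ?ok \<alpha> e)}"
    using prokhorov_dist_nonneg[OF assms] iff[of ?d] by simp
  show "?d \<le> e" if "e \<in> {e. 0 \<le> e \<and> (\<exists>\<alpha>. finite_borel_measure \<alpha> \<and> ?ok \<alpha> e)}" for e
    using that iff by simp
  assume "measure \<mu> (space \<mu>) \<le> measure \<nu> (space \<nu>)"
  then have "measure \<mu> UNIV \<le> measure \<nu> UNIV"
    by (simp add: finite_borel_measureD(3) assms)
  then obtain \<alpha> where \<alpha>: "finite_borel_measure \<alpha>" "?ok \<alpha> ?d" "distr \<alpha> borel fst = \<mu>"
    "\<And>B. B \<in> sets borel \<Longrightarrow> measure (distr \<alpha> borel snd) B \<le> measure \<nu> B"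
    by (rule ex_dominated_coupling_ok_prokhorov_dist[OF assms]) (rule that)
  moreover have "emeasure \<alpha> (UNIV - msupp \<mu> \<times> msupp \<nu>) = 0"
    by (rule marginals_le_imp_null_outside_supports[OF assms \<alpha>(1)]) (simp_all add: \<alpha>(3,4))
  ultimately show "\<exists>\<alpha>. finite_borel_measure \<alpha> \<and> ?ok \<alpha> ?d \<and> distr \<alpha> borel fst = \<mu>
      \<and> (\<forall>A\<in>sets borel. measure (distr \<alpha> borel snd) A \<le> measure \<nu> A)
      \<and> emeasure \<alpha> (UNIV - msupp \<mu> \<times> msupp \<nu>) = 0"
    by blast
qed

end
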